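(* Let $0<r<1$. Let $\operatorname{Sp}\mathbb{A}$ be the class of all Hilbert space operators for which the closed annulus $\{r\le|z|\le1\}$ is a $1$-spectral set, let $\mathbf{C}_\alpha$ be the class of all invertible bounded Hilbert space operators $T$ such that $-T^{*2}T^2+(1+r^2)T^*T-r^2I\ge 0$, and let $\mathbf{C}_{1,r}$ be the class of all bounded invertible Hilbert space operators $T$ such that $\|T\|\le1$ and $\|T^{-1}\|\le 1/r$. Then $$\operatorname{Sp}\mathbb{A}\subsetneq\mathbf{C}_\alpha\subsetneq\mathbf{C}_{1,r}.$$
   Context: All operators are bounded linear operators on complex Hilbert spaces. $\mathbb{A}=\{z\in\mathbb{C}: r<|z|<1\}$, with closure $\mathbb{A}^{\mathrm{cl}}=\{r\le|z|\le1\}$. For an operator $T$ with spectrum contained in $\mathbb{A}^{\mathrm{cl}}$, the set $\mathbb{A}^{\mathrm{cl}}$ is called $1$-spectral for $T$ if $\|f(T)\|\le\max_{z\in\mathbb{A}^{\mathrm{cl}}}|f(z)|$ for every rational function $f$ with poles outside $\mathbb{A}^{\mathrm{cl}}$. *)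

theory Defs
  imports "HOL-Analysis.Analysis" "HOL-Computational_Algebra.Polynomial"
begin

section \<open>Complex Hilbert spaces\<close>

text \<open>A complex Hilbert space is a complete real inner product space whose real structure is
  the restriction of a complex vector space structure, and whose real inner product is the real
  part of a sesquilinear form. The norm and the topology are those of \<^class>\<open>real_inner\<close>.
  The complex inner product is linear in the first argument.\<close>

class complex_vector = real_vector +
  fixes scaleC :: "complex \<Rightarrow> 'a \<Rightarrow> 'a" (infixr "*\<^sub>C" 75)
  assumes scaleC_add_right: "a *\<^sub>C (x + y) = a *\<^sub>C x + a *\<^sub>C y"
    and scaleC_add_left: "(a + b) *\<^sub>C x = a *\<^sub>C x + b *\<^sub>C x"
    and scaleC_scaleC: "a *\<^sub>C (b *\<^sub>C x) = (a * b) *\<^sub>C x"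
    and scaleC_of_real: "complex_of_real t *\<^sub>C x = t *\<^sub>R x"

class complex_inner = complex_vector + real_inner +
  fixes cinner :: "'a \<Rightarrow> 'a \<Rightarrow> complex"
  assumes cinner_commute: "cinner x y = cnj (cinner y x)"
    and cinner_add_left: "cinner (x + y) z = cinner x z + cinner y z"
    and cinner_scaleC_left: "cinner (a *\<^sub>C x) y = a * cinner x y"
    and inner_eq_Re_cinner: "inner x y = Re (cinner x y)"

class chilbert_space = complex_inner + banach


section \<open>Bounded operators\<close>

definition bounded_clinear :: "('a::complex_inner \<Rightarrow> 'b::complex_inner) \<Rightarrow> bool" where
  "bounded_clinear T \<longleftrightarrow> bounded_linear T \<and> (\<forall>a x. T (a *\<^sub>C x) = a *\<^sub>C T x)"

definition invertible_op :: "('a::complex_inner \<Rightarrow> 'a) \<Rightarrow> bool" where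
  "invertible_op T \<longleftrightarrow> (\<exists>S. bounded_clinear S \<and> S \<circ> T = id \<and> T \<circ> S = id)"

definition spectrum :: "('a::complex_inner \<Rightarrow> 'a) \<Rightarrow> complex set" where
  "spectrum T = {z. \<not> invertible_op (\<lambda>x. T x - z *\<^sub>C x)}"

text \<open>On a Hilbert space the description below is met by exactly one \<open>S\<close> whenever \<open>T\<close> is
  bounded, by the Riesz representation theorem.\<close>

definition cadjoint :: "('a::chilbert_space \<Rightarrow> 'a) \<Rightarrow> 'a \<Rightarrow> 'a" where
  "cadjoint T = (THE S. \<forall>x y. cinner (T x) y = cinner x (S y))"

definition positive_op :: "('a::complex_inner \<Rightarrow> 'a) \<Rightarrow> bool" where
  "positive_op A \<longleftrightarrow> (\<forall>x. cinner (A x) x \<in> \<real>\<^sub>\<ge>\<^sub>0)"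


section \<open>Rational functional calculus and spectral sets\<close>

definition poly_op :: "complex poly \<Rightarrow> ('a::complex_inner \<Rightarrow> 'a) \<Rightarrow> 'a \<Rightarrow> 'a" where
  "poly_op p T x = (\<Sum>i\<le>degree p. coeff p i *\<^sub>C (T ^^ i) x)"

text \<open>A rational function with poles outside \<open>X\<close> is a quotient \<open>p / q\<close> of polynomials where \<open>q\<close>
  has no zero in \<open>X\<close>. If the spectrum of \<open>T\<close> lies in \<open>X\<close>, then \<open>q(T)\<close> is invertible and
  \<open>(p / q)(T) = p(T) q(T)\<^sup>-\<^sup>1\<close> does not depend on the choice of \<open>p\<close> and \<open>q\<close>.\<close>

definition rational_op ::
  "complex poly \<Rightarrow> complex poly \<Rightarrow> ('a::complex_inner \<Rightarrow> 'a) \<Rightarrow> 'a \<Rightarrow> 'a" where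
  "rational_op p q T = poly_op p T \<circ> inv (poly_op q T)"

text \<open>For compact nonempty \<open>X\<close> the supremum is attained, hence a maximum.\<close>

definition one_spectral :: "complex set \<Rightarrow> ('a::complex_inner \<Rightarrow> 'a) \<Rightarrow> bool" where
  "one_spectral X T \<longleftrightarrow> spectrum T \<subseteq> X \<and>
     (\<forall>p q. (\<forall>z\<in>X. poly q z \<noteq> 0) \<longrightarrow>
        onorm (rational_op p q T) \<le> (SUP z\<in>X. cmod (poly p z / poly q z)))"


section \<open>The three operator classes\<close>

definition closed_annulus :: "real \<Rightarrow> complex set" where
  "closed_annulus r = {z. r \<le> cmod z \<and> cmod z \<le> 1}"

definition Sp_annulus :: "real \<Rightarrow> ('a::chilbert_space \<Rightarrow> 'a) set" where
  "Sp_annulus r = {T. bounded_clinear T \<and> one_spectral (closed_annulus r) T}"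

definition C_alpha :: "real \<Rightarrow> ('a::chilbert_space \<Rightarrow> 'a) set" where
  "C_alpha r = {T. bounded_clinear T \<and> invertible_op T \<and>
     positive_op (\<lambda>x. - (cadjoint T ^^ 2) ((T ^^ 2) x)
                      + (1 + r\<^sup>2) *\<^sub>R cadjoint T (T x) - r\<^sup>2 *\<^sub>R x)}"

definition C_1r :: "real \<Rightarrow> ('a::chilbert_space \<Rightarrow> 'a) set" where
  "C_1r r = {T. bounded_clinear T \<and> invertible_op T \<and> onorm T \<le> 1 \<and> onorm (inv T) \<le> 1 / r}"


section \<open>The Hilbert space of square-summable sequences\<close>

text \<open>Strictness of an inclusion between two of the classes asks for an operator on some Hilbert
  space. HOL has no existential quantifier over types, so the operator is sought on \<open>\<ell>\<^sup>2(\<nat>)\<close>.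
  This loses nothing: a separating operator can be restricted to a separable reducing subspace and
  completed by the direct sum with \<open>c I\<close>, \<open>r \<le> \<bar>c\<bar> \<le> 1\<close>, which lies in all three classes.\<close>

typedef ell2 = "{x :: nat \<Rightarrow> complex. summable (\<lambda>n. (cmod (x n))\<^sup>2)}"
  morphisms ell2_nth Abs_ell2
  by (rule exI[of _ "\<lambda>_. 0"]) simp

setup_lifting type_definition_ell2

lemma ell2_summable: "summable (\<lambda>n. (cmod (ell2_nth x n))\<^sup>2)"
  using ell2_nth by blast

lemma ell2_eqI: "(\<And>n. ell2_nth x n = ell2_nth y n) \<Longrightarrow> x = y"
  by (metis ell2_nth_inject ext)

lemma norm_add_sq_le: "(cmod (a + b))\<^sup>2 \<le> 2 * (cmod a)\<^sup>2 + 2 * (cmod b)\<^sup>2"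
proof -
  have "(cmod (a + b))\<^sup>2 \<le> (cmod a + cmod b)\<^sup>2"
    by (simp add: norm_triangle_ineq power_mono)
  also have "\<dots> \<le> 2 * (cmod a)\<^sup>2 + 2 * (cmod b)\<^sup>2"
    using zero_le_power2[of "cmod a - cmod b"] by (simp add: power2_eq_square algebra_simps)
  finally show ?thesis .
qed

lemma square_summable_add:
  assumes "summable (\<lambda>n. (cmod (x n))\<^sup>2)" "summable (\<lambda>n. (cmod (y n))\<^sup>2)"
  shows "summable (\<lambda>n. (cmod (x n + y n))\<^sup>2)"
  by (rule summable_comparison_test'[of "\<lambda>n. 2 * (cmod (x n))\<^sup>2 + 2 * (cmod (y n))\<^sup>2" 0])
     (use assms norm_add_sq_le in \<open>auto intro!: summable_add summable_mult\<close>)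

lemma square_summable_scale:
  assumes "summable (\<lambda>n. (cmod (x n))\<^sup>2)"
  shows "summable (\<lambda>n. (cmod (a * x n))\<^sup>2)"
  using summable_mult[OF assms, of "(cmod a)\<^sup>2"] by (simp add: norm_mult power_mult_distrib)

lemma square_summable_cinner:
  assumes "summable (\<lambda>n. (cmod (x n))\<^sup>2)" "summable (\<lambda>n. (cmod (y n))\<^sup>2)"
  shows "summable (\<lambda>n. x n * cnj (y n))"
proof (rule summable_comparison_test'[of "\<lambda>n. (cmod (x n))\<^sup>2 + (cmod (y n))\<^sup>2" 0])
  show "summable (\<lambda>n. (cmod (x n))\<^sup>2 + (cmod (y n))\<^sup>2)"
    using assms by (rule summable_add)
  fix n
  have "2 * (cmod (x n) * cmod (y n)) \<le> (cmod (x n))\<^sup>2 + (cmod (y n))\<^sup>2"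
    using zero_le_power2[of "cmod (x n) - cmod (y n)"]
    by (simp add: power2_eq_square algebra_simps)
  moreover have "0 \<le> cmod (x n) * cmod (y n)" by simp
  ultimately have "cmod (x n) * cmod (y n) \<le> (cmod (x n))\<^sup>2 + (cmod (y n))\<^sup>2" by linarith
  then show "norm (x n * cnj (y n)) \<le> (cmod (x n))\<^sup>2 + (cmod (y n))\<^sup>2"
    by (simp add: norm_mult)
qed

instantiation ell2 :: complex_vector
begin

lift_definition zero_ell2 :: ell2 is "\<lambda>_. 0" by simp
lift_definition plus_ell2 :: "ell2 \<Rightarrow> ell2 \<Rightarrow> ell2" is "\<lambda>x y n. x n + y n"
  by (rule square_summable_add)
lift_definition uminus_ell2 :: "ell2 \<Rightarrow> ell2" is "\<lambda>x n. - x n" by simp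
lift_definition minus_ell2 :: "ell2 \<Rightarrow> ell2 \<Rightarrow> ell2" is "\<lambda>x y n. x n - y n"
  using square_summable_add[where y = "\<lambda>n. - y n" for y] by simp
lift_definition scaleR_ell2 :: "real \<Rightarrow> ell2 \<Rightarrow> ell2" is "\<lambda>t x n. complex_of_real t * x n"
  by (rule square_summable_scale)
lift_definition scaleC_ell2 :: "complex \<Rightarrow> ell2 \<Rightarrow> ell2" is "\<lambda>a x n. a * x n"
  by (rule square_summable_scale)

instance
  by (intro_classes; transfer) (auto simp: algebra_simps)

end

instantiation ell2 :: complex_inner
begin

definition cinner_ell2_def:
  "cinner x y = (\<Sum>n. ell2_nth x n * cnj (ell2_nth y n))"
definition inner_ell2_def: "inner (x::ell2) y = Re (cinner x y)"
definition norm_ell2_def: "norm (x::ell2) = sqrt (inner x x)"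
definition dist_ell2_def: "dist (x::ell2) y = norm (x - y)"
definition sgn_ell2_def: "sgn (x::ell2) = x /\<^sub>R norm x"
definition uniformity_ell2_def:
  "(uniformity :: (ell2 \<times> ell2) filter) = (INF e\<in>{0<..}. principal {(x, y). dist x y < e})"
definition open_ell2_def:
  "open (U::ell2 set) \<longleftrightarrow> (\<forall>x\<in>U. eventually (\<lambda>(x', y). x' = x \<longrightarrow> y \<in> U) uniformity)"

lemma ell2_cinner_summable: "summable (\<lambda>n. ell2_nth x n * cnj (ell2_nth y n))"
  by (intro square_summable_cinner ell2_summable)

lemma ell2_inner_self: "inner x x = (\<Sum>n. (cmod (ell2_nth x n))\<^sup>2)" for x :: ell2
proof -
  have "(\<lambda>n. ell2_nth x n * cnj (ell2_nth x n)) sums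
      complex_of_real (\<Sum>n. (cmod (ell2_nth x n))\<^sup>2)"
    using sums_of_real[OF summable_sums[OF ell2_summable[of x]], where 'a = complex]
    by (simp only: complex_norm_square)
  then have "cinner x x = complex_of_real (\<Sum>n. (cmod (ell2_nth x n))\<^sup>2)"
    unfolding cinner_ell2_def by (rule sums_unique[symmetric])
  then show ?thesis by (simp add: inner_ell2_def)
qed

instance
proof
  fix x y z :: ell2 and a :: complex and t :: real
  show comm: "cinner x y = cnj (cinner y x)" for x y :: ell2
  proof -
    have "(\<lambda>n. cnj (ell2_nth y n * cnj (ell2_nth x n))) sums cnj (cinner y x)"
      unfolding cinner_ell2_def sums_cnj using ell2_cinner_summable by (rule summable_sums)
    then show ?thesis
      unfolding cinner_ell2_def[of x y] by (simp add: sums_iff mult.commute)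
  qed
  show add: "cinner (x + y) z = cinner x z + cinner y z"
    unfolding cinner_ell2_def
    by (simp add: plus_ell2.rep_eq distrib_right suminf_add ell2_cinner_summable)
  show scale: "cinner (a *\<^sub>C x) y = a * cinner x y" for a
    unfolding cinner_ell2_def
    by (simp add: scaleC_ell2.rep_eq mult.assoc suminf_mult ell2_cinner_summable)
  show "inner x y = Re (cinner x y)" by (rule inner_ell2_def)
  show "inner x y = inner y x"
    unfolding inner_ell2_def by (subst comm) simp
  show "inner (x + y) z = inner x z + inner y z"
    by (simp add: inner_ell2_def add)
  show "inner (t *\<^sub>R x) y = t * inner x y"
    using scale[of "complex_of_real t"] by (simp add: inner_ell2_def scaleC_of_real)
  show "0 \<le> inner x x"
    by (simp add: ell2_inner_self suminf_nonneg ell2_summable)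
  show "(inner x x = 0) = (x = 0)"
    by (auto simp: ell2_inner_self suminf_eq_zero_iff ell2_summable zero_ell2.rep_eq
        intro: ell2_eqI)
qed (rule dist_ell2_def sgn_ell2_def uniformity_ell2_def open_ell2_def norm_ell2_def)+

end

lemma norm_ell2_sq: "(norm x)\<^sup>2 = (\<Sum>n. (cmod (ell2_nth x n))\<^sup>2)"
  by (simp add: power2_norm_eq_inner ell2_inner_self)

lemma sum_le_norm_ell2_sq: "(\<Sum>n<N. (cmod (ell2_nth x n))\<^sup>2) \<le> (norm x)\<^sup>2"
  unfolding norm_ell2_sq by (rule sum_le_suminf) (auto simp: ell2_summable)

lemma cmod_ell2_nth_le: "cmod (ell2_nth x n) \<le> norm x"
proof -
  have "(cmod (ell2_nth x n))\<^sup>2 \<le> (\<Sum>k<Suc n. (cmod (ell2_nth x k))\<^sup>2)"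
    by (simp add: sum_nonneg)
  then show ?thesis
    using sum_le_norm_ell2_sq[of x "Suc n"] by (meson norm_ge_zero order_trans power2_le_imp_le)
qed

instance ell2 :: chilbert_space
proof
  fix X :: "nat \<Rightarrow> ell2"
  assume X: "Cauchy X"
  have "Cauchy (\<lambda>k. ell2_nth (X k) n)" for n
  proof (rule metric_CauchyI)
    fix e :: real assume "0 < e"
    with X obtain M where "\<forall>k\<ge>M. \<forall>m\<ge>M. dist (X k) (X m) < e"
      by (meson metric_CauchyD)
    then show "\<exists>M. \<forall>k\<ge>M. \<forall>m\<ge>M. dist (ell2_nth (X k) n) (ell2_nth (X m) n) < e"
      using cmod_ell2_nth_le[of "X k - X m" n for k m]
      by (metis (no_types, lifting) dist_norm minus_ell2.rep_eq order_le_less_trans)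
  qed
  then have "\<forall>n. \<exists>l. (\<lambda>k. ell2_nth (X k) n) \<longlonglongrightarrow> l"
    by (simp add: Cauchy_convergent_iff convergent_def)
  then obtain l where l: "\<And>n. (\<lambda>k. ell2_nth (X k) n) \<longlonglongrightarrow> l n"
    by metis
  have bound: "(\<Sum>n<N. (cmod (ell2_nth (X k) n - l n))\<^sup>2) \<le> e\<^sup>2"
    if M: "\<forall>k\<ge>M. \<forall>m\<ge>M. dist (X k) (X m) < e" and "0 < e" "M \<le> k" for M e k N
  proof (rule tendsto_upperbound)
    show "(\<lambda>m. \<Sum>n<N. (cmod (ell2_nth (X k) n - ell2_nth (X m) n))\<^sup>2)
        \<longlonglongrightarrow> (\<Sum>n<N. (cmod (ell2_nth (X k) n - l n))\<^sup>2)"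
      by (intro tendsto_intros l)
    have "(\<Sum>n<N. (cmod (ell2_nth (X k) n - ell2_nth (X m) n))\<^sup>2) \<le> e\<^sup>2" if "M \<le> m" for m
    proof -
      have "(\<Sum>n<N. (cmod (ell2_nth (X k) n - ell2_nth (X m) n))\<^sup>2) \<le> (norm (X k - X m))\<^sup>2"
        using sum_le_norm_ell2_sq[of "X k - X m" N] by (simp add: minus_ell2.rep_eq)
      also have "\<dots> \<le> e\<^sup>2"
        using M \<open>M \<le> k\<close> that by (intro power_mono) (auto simp: dist_norm less_imp_le)
      finally show ?thesis .
    qed
    then show "\<forall>\<^sub>F m in sequentially.
        (\<Sum>n<N. (cmod (ell2_nth (X k) n - ell2_nth (X m) n))\<^sup>2) \<le> e\<^sup>2"
      by (auto simp: eventually_sequentially)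
  qed simp
  have diff: "summable (\<lambda>n. (cmod (ell2_nth (X k) n - l n))\<^sup>2)"
    "(\<Sum>n. (cmod (ell2_nth (X k) n - l n))\<^sup>2) \<le> e\<^sup>2"
    if "\<forall>k\<ge>M. \<forall>m\<ge>M. dist (X k) (X m) < e" "0 < e" "M \<le> k" for M e k
  proof -
    show *: "summable (\<lambda>n. (cmod (ell2_nth (X k) n - l n))\<^sup>2)"
      using bound[OF that] by (intro summableI_nonneg_bounded) auto
    show "(\<Sum>n. (cmod (ell2_nth (X k) n - l n))\<^sup>2) \<le> e\<^sup>2"
      using bound[OF that] by (intro suminf_le_const *)
  qed
  obtain M where M: "\<forall>k\<ge>M. \<forall>m\<ge>M. dist (X k) (X m) < 1"
    using metric_CauchyD[OF X, of 1] by auto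
  have "summable (\<lambda>n. (cmod (ell2_nth (X M) n + (-1) * (ell2_nth (X M) n - l n)))\<^sup>2)"
    using ell2_summable diff(1)[OF M] by (intro square_summable_add square_summable_scale) auto
  then have "summable (\<lambda>n. (cmod (l n))\<^sup>2)" by simp
  then obtain L where L: "ell2_nth L = l"
    by (metis (mono_tags) Abs_ell2_inverse mem_Collect_eq)
  have "X \<longlonglongrightarrow> L"
  proof (rule metric_LIMSEQ_I)
    fix e :: real assume "0 < e"
    then obtain M where M: "\<forall>k\<ge>M. \<forall>m\<ge>M. dist (X k) (X m) < e / 2"
      using metric_CauchyD[OF X, of "e / 2"] by auto
    have "dist (X k) L < e" if "M \<le> k" for k
    proof -
      have "(norm (X k - L))\<^sup>2 \<le> (e / 2)\<^sup>2"
        using diff(2)[OF M _ that] \<open>0 < e\<close> by (simp add: norm_ell2_sq minus_ell2.rep_eq L)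
      then have "norm (X k - L) \<le> e / 2"
        by (rule power2_le_imp_le) (use \<open>0 < e\<close> in simp)
      then show ?thesis using \<open>0 < e\<close> by (simp add: dist_norm)
    qed
    then show "\<exists>M. \<forall>k\<ge>M. dist (X k) L < e" by blast
  qed
  then show "convergent X" by (auto simp: convergent_def)
qed

end

theory Submission
  imports Defs "HOL-Complex_Analysis.Complex_Analysis"
begin

text \<open>All three conditions speak of the numbers \<open>k\<^sub>n = \<parallel>T\<^sup>n x\<parallel>\<^sup>2\<close>. The operator inequality that
  defines \<open>C_alpha r\<close> says \<open>k\<^sub>2 + r\<^sup>2 k\<^sub>0 \<le> (1 + r\<^sup>2) k\<^sub>1\<close> for every \<open>x\<close>; this reading needs the adjoint
  to exist, that is, the Riesz representation theorem.

  If the annulus is \<open>1\<close>-spectral for \<open>T\<close>, then \<open>Re f \<ge> 0\<close> on the annulus forces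
  \<open>Re \<langle>f(T) u, u\<rangle> \<ge> 0\<close>. The extreme choice of \<open>f\<close> is the function whose real part has boundary
  values a point mass at \<open>1\<close> and a point mass at \<open>r\<close>, that is
  \<open>f(z) = \<Sum>n. 2 z\<^sup>n / (1 + r\<^sup>n)\<close> over all integers \<open>n\<close>. Take \<open>u = g(T) x\<close> with
  \<open>g(z) = (1 - z) (r - z) = r - (1 + r) z + z\<^sup>2\<close>, which cancels the two poles of \<open>f\<close> on the boundary.
  Averaging over the rotations \<open>\<omega> T\<close>, for which the annulus is \<open>1\<close>-spectral as well, removes all inner
  products \<open>\<langle>T\<^sup>m x, T\<^sup>n x\<rangle>\<close> with \<open>m \<noteq> n\<close>, and what is left is
  \<open>(1 - r)\<^sup>2 / (1 + r\<^sup>2) * ((1 + r\<^sup>2) k\<^sub>1 - k\<^sub>2 - r\<^sup>2 k\<^sub>0) \<ge> 0\<close>, the inequality of \<open>C_alpha r\<close>.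
  The function \<open>f\<close> is replaced by its Fejer means, which are Laurent polynomials and keep a nonnegative
  real part; see \<open>annulus_fejer_Re_nonneg\<close>,
  \<open>Sp_annulus_averaged\<close> and \<open>Sp_annulus_moment_form_nonneg\<close>.

  For \<open>C_alpha r \<subseteq> C_1r r\<close>, the inequality is read along the two-sided orbit of \<open>x\<close>, as a recursion for
  the differences \<open>k\<^sub>n\<^sub>+\<^sub>1 - k\<^sub>n\<close> and \<open>k\<^sub>n\<^sub>+\<^sub>1 - r\<^sup>2 k\<^sub>n\<close>: if one of them had the wrong sign, it would keep
  a distance from \<open>0\<close>, for \<open>n \<rightarrow> -\<infinity>\<close> or for \<open>n \<rightarrow> \<infinity>\<close> respectively, and \<open>k\<^sub>n\<close> would become negative.

  Both separating operators have the form \<open>(x\<^sub>0, x\<^sub>1, x\<^sub>2, \<dots>) \<mapsto> (a x\<^sub>1, b x\<^sub>0, x\<^sub>2, \<dots>)\<close>. With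
  \<open>a = 1\<close> and \<open>b = r\<close> the norm bounds hold and the inequality fails at the first unit vector. With
  \<open>a = sqrt ((1 + r\<^sup>2) / 2)\<close> and \<open>b = r / a\<close> the inequality holds, but \<open>f(z) = z + r / z\<close>, whose
  modulus is at most \<open>1 + r\<close> on the annulus, gives an operator of norm at least \<open>2 a > 1 + r\<close>.\<close>

section \<open>Complex inner product spaces\<close>

lemma scaleC_zero_left [simp]: "0 *\<^sub>C x = (0 :: 'a::complex_vector)"
  using scaleC_of_real[of 0 x] by simp

lemma scaleC_one [simp]: "1 *\<^sub>C x = (x :: 'a::complex_vector)"
  using scaleC_of_real[of 1 x] by simp

lemma scaleC_zero_right [simp]: "a *\<^sub>C 0 = (0 :: 'a::complex_vector)"
  using scaleC_add_right[of a 0 0] by simp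

lemma scaleC_sum_right: "a *\<^sub>C (\<Sum>i\<in>I. f i) = (\<Sum>i\<in>I. a *\<^sub>C (f i :: 'a::complex_vector))"
  by (induction I rule: infinite_finite_induct) (auto simp: scaleC_add_right)

lemma cinner_add_right: "cinner x (y + z) = cinner x y + cinner x (z :: 'a::complex_inner)"
  by (metis cinner_add_left cinner_commute complex_cnj_add)

lemma cinner_scaleC_right: "cinner x (a *\<^sub>C y) = cnj a * cinner x (y :: 'a::complex_inner)"
  by (metis cinner_commute cinner_scaleC_left complex_cnj_mult)

lemma cinner_zero_left [simp]: "cinner 0 (x :: 'a::complex_inner) = 0"
  using cinner_add_left[of 0 0 x] by simp

lemma cinner_zero_right [simp]: "cinner (x :: 'a::complex_inner) 0 = 0"
  using cinner_add_right[of x 0 0] by simp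

lemma cinner_scaleR_left: "cinner (t *\<^sub>R x) y = of_real t * cinner x (y :: 'a::complex_inner)"
  by (metis cinner_scaleC_left scaleC_of_real)

lemma cinner_minus_left: "cinner (- x) y = - cinner x (y :: 'a::complex_inner)"
  using cinner_scaleR_left[of "-1" x y] by simp

lemma cinner_diff_left: "cinner (x - z) y = cinner x y - cinner z (y :: 'a::complex_inner)"
  using cinner_add_left[of x "-z" y] by (simp add: cinner_minus_left)

lemma cinner_sum_left: "cinner (\<Sum>i\<in>I. f i) x = (\<Sum>i\<in>I. cinner (f i) (x :: 'a::complex_inner))"
  by (induction I rule: infinite_finite_induct) (auto simp: cinner_add_left)

lemma cinner_sum_right: "cinner x (\<Sum>i\<in>I. f i) = (\<Sum>i\<in>I. cinner x (f i :: 'a::complex_inner))"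
  by (induction I rule: infinite_finite_induct) (auto simp: cinner_add_right)

lemma cinner_self: "cinner x x = complex_of_real ((norm (x :: 'a::complex_inner))\<^sup>2)"
proof -
  have "Im (cinner x x) = 0"
    using arg_cong[OF cinner_commute[of x x], of Im] by simp
  then show ?thesis
    by (simp add: complex_eq_iff power2_norm_eq_inner inner_eq_Re_cinner)
qed

lemma norm_scaleC: "norm (a *\<^sub>C x) = cmod a * norm (x :: 'a::complex_inner)"
proof -
  have "complex_of_real ((norm (a *\<^sub>C x))\<^sup>2) = complex_of_real ((cmod a * norm x)\<^sup>2)"
    unfolding cinner_self[symmetric] cinner_scaleC_left cinner_scaleC_right
    unfolding of_real_mult power_mult_distrib complex_norm_square by (simp add: cinner_self mult_ac)
  then show ?thesis
    by (simp only: of_real_eq_iff) (simp add: power2_eq_iff_nonneg)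
qed


section \<open>Bounded operators, their powers and their polynomials\<close>

lemma bounded_clinear_id: "bounded_clinear (\<lambda>x :: 'a::complex_inner. x)"
  by (simp add: bounded_clinear_def)

lemma bounded_clinear_compose:
  "bounded_clinear S \<Longrightarrow> bounded_clinear T \<Longrightarrow> bounded_clinear (\<lambda>x. S (T x))"
  by (auto simp: bounded_clinear_def intro: bounded_linear_compose)

lemma bounded_clinear_funpow:
  fixes T :: "'a::complex_inner \<Rightarrow> 'a"
  assumes "bounded_clinear T"
  shows "bounded_clinear (T ^^ n)"
proof (induction n)
  case (Suc n)
  then show ?case
    using bounded_clinear_compose[OF assms, of "T ^^ n"] by (simp add: comp_def)
qed (simp add: bounded_clinear_id id_def)

lemma bounded_clinear_add:
  "bounded_clinear S \<Longrightarrow> bounded_clinear T \<Longrightarrow> bounded_clinear (\<lambda>x. S x + T x)"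
  by (auto simp: bounded_clinear_def scaleC_add_right intro: bounded_linear_add)

lemma bounded_clinear_scaleC:
  fixes T :: "'a::complex_inner \<Rightarrow> 'b::complex_inner"
  assumes "bounded_clinear T"
  shows "bounded_clinear (\<lambda>x. a *\<^sub>C T x)"
proof -
  have "bounded_linear (\<lambda>x :: 'b. a *\<^sub>C x)"
    by (rule bounded_linear_intro[where K = "cmod a"])
       (auto simp: scaleC_add_right norm_scaleC scaleC_scaleC mult.commute simp flip: scaleC_of_real)
  then show ?thesis
    using assms by (auto simp: bounded_clinear_def scaleC_scaleC mult.commute
        intro: bounded_linear_compose)
qed

lemma bounded_clinear_sum:
  assumes "\<And>i. i \<in> I \<Longrightarrow> bounded_clinear (f i)"
  shows "bounded_clinear (\<lambda>x. \<Sum>i\<in>I. f i x :: 'b::complex_inner)"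
  using assms
proof (induction I rule: infinite_finite_induct)
  case (insert i I)
  then show ?case by (simp add: bounded_clinear_add)
qed (auto simp: bounded_clinear_def)

lemma bounded_clinear_poly_op:
  assumes "bounded_clinear T"
  shows "bounded_clinear (poly_op p T)"
  unfolding poly_op_def
  by (intro bounded_clinear_sum bounded_clinear_scaleC bounded_clinear_funpow assms)

lemma clinear_sum:
  assumes "bounded_clinear T"
  shows "T (\<Sum>i\<in>I. c i *\<^sub>C x i) = (\<Sum>i\<in>I. c i *\<^sub>C T (x i))"
  using assms linear_sum[of T "\<lambda>i. c i *\<^sub>C x i" I]
  by (simp add: bounded_clinear_def bounded_linear.linear)

lemma poly_op_eq:
  assumes "degree p \<le> n"
  shows "poly_op p T x = (\<Sum>i\<le>n. coeff p i *\<^sub>C (T ^^ i) x)"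
  unfolding poly_op_def using assms
  by (intro sum.mono_neutral_left) (auto simp: coeff_eq_0)

lemma poly_op_add: "poly_op (p + q) T x = poly_op p T x + poly_op q T x"
proof -
  let ?n = "max (degree p) (degree q)"
  show ?thesis
    using poly_op_eq[of p ?n T x] poly_op_eq[of q ?n T x] poly_op_eq[of "p + q" ?n T x]
    by (simp add: degree_add_le_max scaleC_add_left sum.distrib)
qed

lemma poly_op_sum: "poly_op (\<Sum>i\<in>I. p i) T x = (\<Sum>i\<in>I. poly_op (p i) T x)"
  by (induction I rule: infinite_finite_induct) (auto simp: poly_op_add, auto simp: poly_op_def)

lemma poly_op_monom: "poly_op (monom c n) T x = c *\<^sub>C (T ^^ n) x"
proof -
  have "poly_op (monom c n) T x = (\<Sum>i\<le>n. (if i = n then c *\<^sub>C (T ^^ i) x else 0))"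
    unfolding poly_op_eq[OF degree_monom_le] by (intro sum.cong) auto
  then show ?thesis by simp
qed

lemma poly_op_smult: "poly_op (smult c p) T x = c *\<^sub>C poly_op p T x"
  unfolding poly_op_eq[OF degree_smult_le] poly_op_def
  by (simp add: scaleC_sum_right scaleC_scaleC)

lemma funpow_inverse:
  fixes T S :: "'a \<Rightarrow> 'a"
  assumes "S \<circ> T = id"
  shows "(S ^^ n) ((T ^^ n) x) = x"
proof (induction n arbitrary: x)
  case (Suc n)
  have "(S ^^ Suc n) ((T ^^ Suc n) x) = (S ^^ n) (S (T ((T ^^ n) x)))"
    by (simp add: funpow_swap1)
  with Suc assms show ?case by (simp add: pointfree_idE)
qed simp


section \<open>Adjoints\<close>

text \<open>If \<open>f\<close> is not zero, the minimal vector of the hyperplane \<open>{x. f x = 1}\<close>, divided by the square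
  of its norm, represents \<open>f\<close>: it exists because the parallelogram law makes a minimizing sequence Cauchy.\<close>

lemma riesz_representation:
  fixes f :: "'a::{real_inner, banach} \<Rightarrow> real"
  assumes f: "bounded_linear f"
  shows "\<exists>z. \<forall>x. f x = inner x z"
proof (cases "\<forall>x. f x = 0")
  case True
  then show ?thesis by (intro exI[of _ 0]) simp
next
  case False
  interpret f: bounded_linear f by (rule f)
  from False obtain x0 where x0: "f x0 \<noteq> 0" by blast
  define K where "K = {x. f x = 1}"
  define d where "d = (INF x\<in>K. (norm x)\<^sup>2)"
  have ne: "K \<noteq> {}"
    using x0 by (auto simp: K_def f.scaleR intro!: exI[of _ "x0 /\<^sub>R f x0"])
  have bdd: "bdd_below ((\<lambda>x. (norm x)\<^sup>2) ` K)" by (rule bdd_belowI2[of _ 0]) simp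
  have d_le: "d \<le> (norm x)\<^sup>2" if "x \<in> K" for x
    unfolding d_def by (rule cINF_lower[OF bdd that])
  have "\<exists>x\<in>K. (norm x)\<^sup>2 < d + 1 / real (Suc n)" for n
    using cINF_less_iff[OF ne bdd, of "d + 1 / real (Suc n)"] by (simp add: d_def)
  then obtain X where XK: "\<And>n. X n \<in> K" and Xd: "\<And>n. (norm (X n))\<^sup>2 < d + 1 / real (Suc n)"
    by metis
  have close: "(norm (X m - X n))\<^sup>2 \<le> 2 / real (Suc m) + 2 / real (Suc n)" for m n
  proof -
    have "(1/2) *\<^sub>R (X m + X n) \<in> K"
      using XK[of m] XK[of n] by (simp add: K_def f.scaleR f.add)
    from d_le[OF this] have "4 * d \<le> (norm (X m + X n))\<^sup>2"
      by (simp add: power_mult_distrib power_divide)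
    moreover have "(norm (X m - X n))\<^sup>2 + (norm (X m + X n))\<^sup>2
        = 2 * (norm (X m))\<^sup>2 + 2 * (norm (X n))\<^sup>2"
      by (simp add: power2_norm_eq_inner inner_add inner_diff inner_commute)
    ultimately show ?thesis using Xd[of m] Xd[of n] by simp
  qed
  have "Cauchy X"
  proof (rule metric_CauchyI)
    fix e :: real assume "0 < e"
    then obtain M where M: "4 / e\<^sup>2 < real (Suc M)"
      using reals_Archimedean2[of "4 / e\<^sup>2"] by (metis less_SucI of_nat_less_iff less_trans lessI)
    have "dist (X m) (X n) < e" if "M \<le> m" "M \<le> n" for m n
    proof -
      have "2 / real (Suc k) \<le> 2 / real (Suc M)" if "M \<le> k" for k
        using that by (intro divide_left_mono) auto
      with that have "(norm (X m - X n))\<^sup>2 \<le> 4 / real (Suc M)"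
        using close[of m n] by (smt (verit) add_divide_distrib)
      also have "\<dots> < e\<^sup>2" using M \<open>0 < e\<close> by (simp add: field_simps)
      finally show ?thesis
        using \<open>0 < e\<close> by (simp add: dist_norm power_less_imp_less_base)
    qed
    then show "\<exists>M. \<forall>m\<ge>M. \<forall>n\<ge>M. dist (X m) (X n) < e" by blast
  qed
  then obtain z where z: "X \<longlonglongrightarrow> z" by (auto simp: Cauchy_convergent_iff convergent_def)
  have "f z = 1"
    using f.tendsto[OF z] XK by (simp add: K_def LIMSEQ_const_iff)
  have "(norm z)\<^sup>2 \<le> d"
  proof (rule LIMSEQ_le)
    show "(\<lambda>n. (norm (X n))\<^sup>2) \<longlonglongrightarrow> (norm z)\<^sup>2" by (intro tendsto_intros z)
    show "(\<lambda>n. d + 1 / real (Suc n)) \<longlonglongrightarrow> d"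
      using tendsto_add[OF tendsto_const[of d] LIMSEQ_inverse_real_of_nat]
      by (simp add: inverse_eq_divide)
  qed (use Xd less_imp_le in blast)
  have orth: "inner k z = 0" if "f k = 0" for k
  proof (rule ccontr)
    assume ne: "inner k z \<noteq> 0"
    then have "k \<noteq> 0" by auto
    define t where "t = - inner k z / (norm k)\<^sup>2"
    have "z + t *\<^sub>R k \<in> K" using \<open>f z = 1\<close> that by (simp add: K_def f.add f.scaleR)
    then have "(norm z)\<^sup>2 \<le> (norm (z + t *\<^sub>R k))\<^sup>2" using d_le \<open>(norm z)\<^sup>2 \<le> d\<close> order_trans by blast
    also have "\<dots> = (norm z)\<^sup>2 + 2 * t * inner k z + t\<^sup>2 * (norm k)\<^sup>2"
      unfolding power2_norm_eq_inner
      by (simp add: inner_add inner_commute power2_eq_square algebra_simps)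
    also have "\<dots> = (norm z)\<^sup>2 - (inner k z)\<^sup>2 / (norm k)\<^sup>2"
      using \<open>k \<noteq> 0\<close> by (simp add: t_def power2_eq_square field_simps)
    finally show False using ne \<open>k \<noteq> 0\<close> by (simp add: divide_le_0_iff)
  qed
  have "z \<noteq> 0" using \<open>f z = 1\<close> f.zero by auto
  have "f x = inner x (z /\<^sub>R (norm z)\<^sup>2)" for x
    using orth[of "x - f x *\<^sub>R z"] \<open>f z = 1\<close> \<open>z \<noteq> 0\<close>
    by (simp add: f.diff f.scaleR inner_diff power2_norm_eq_inner field_simps)
  then show ?thesis by blast
qed

lemma cinner_eq_inner:
  "cinner x y = Complex (inner x y) (inner ((- \<i>) *\<^sub>C x) (y :: 'a::complex_inner))"
  by (simp add: complex_eq_iff inner_eq_Re_cinner cinner_scaleC_left)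

lemma cinner_cadjoint:
  fixes T :: "'a::chilbert_space \<Rightarrow> 'a"
  assumes T: "bounded_clinear T"
  shows "cinner (T x) y = cinner x (cadjoint T y)"
proof -
  have "\<exists>z. \<forall>x. inner (T x) y = inner x z" for y
    using T bounded_linear_compose[OF bounded_linear_inner_left]
    by (intro riesz_representation) (auto simp: bounded_clinear_def)
  then obtain S where S: "\<And>x y. inner (T x) y = inner x (S y)" by metis
  have *: "\<forall>x y. cinner (T x) y = cinner x (S y)"
    using T by (simp add: cinner_eq_inner S bounded_clinear_def flip: S)
  have "S' = S" if S': "\<forall>x y. cinner (T x) y = cinner x (S' y)" for S'
  proof
    fix y
    have "inner x (S' y) = inner x (S y)" for x
      using * S' by (metis inner_eq_Re_cinner)
    then show "S' y = S y" by (rule vector_eq_ldot[THEN iffD1, OF allI])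
  qed
  with * have "cadjoint T = S" unfolding cadjoint_def by (intro the_equality) auto
  with * show ?thesis by simp
qed

text \<open>The adjoint moves to the other side of the inner product, so that the quadratic form of the
  operator in the definition of \<open>C_alpha r\<close> is a combination of squared norms; in particular it is
  real.\<close>

lemma mem_C_alpha_iff:
  fixes T :: "'a::chilbert_space \<Rightarrow> 'a"
  shows "T \<in> C_alpha r \<longleftrightarrow> bounded_clinear T \<and> invertible_op T \<and>
    (\<forall>x. (norm (T (T x)))\<^sup>2 + r\<^sup>2 * (norm x)\<^sup>2 \<le> (1 + r\<^sup>2) * (norm (T x))\<^sup>2)"
proof -
  let ?A = "\<lambda>x. - (cadjoint T ^^ 2) ((T ^^ 2) x) + (1 + r\<^sup>2) *\<^sub>R cadjoint T (T x) - r\<^sup>2 *\<^sub>R x"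
  have key: "cinner (- (cadjoint T ^^ 2) ((T ^^ 2) x) + (1 + r\<^sup>2) *\<^sub>R cadjoint T (T x) - r\<^sup>2 *\<^sub>R x) x
      = complex_of_real (- (norm (T (T x)))\<^sup>2 + (1 + r\<^sup>2) * (norm (T x))\<^sup>2 - r\<^sup>2 * (norm x)\<^sup>2)"
    if T: "bounded_clinear T" for x
  proof -
    have adj: "cinner (cadjoint T u) v = cinner u (T v)" for u v
      by (metis T cinner_cadjoint cinner_commute)
    show ?thesis
      by (simp add: numeral_2_eq_2 cinner_add_left cinner_diff_left cinner_minus_left
          cinner_scaleR_left adj cinner_self)
  qed
  have "positive_op ?A \<longleftrightarrow>
      (\<forall>x. (norm (T (T x)))\<^sup>2 + r\<^sup>2 * (norm x)\<^sup>2 \<le> (1 + r\<^sup>2) * (norm (T x))\<^sup>2)"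
    if "bounded_clinear T"
    unfolding positive_op_def key[OF that] nonneg_Reals_of_real_iff
    by (intro all_cong1) (auto simp: algebra_simps)
  then show ?thesis unfolding C_alpha_def by blast
qed

section \<open>The quadratic condition implies the norm bounds\<close>

lemma nonneg_bounded_below_drop:
  fixes k :: "nat \<Rightarrow> real"
  assumes "\<And>n. 0 \<le> k n" and "\<And>n. k (Suc n) \<le> k n - c"
  shows "c \<le> 0"
proof (rule ccontr)
  assume "\<not> c \<le> 0"
  moreover obtain n where "k 0 / c < real n" using reals_Archimedean2 by blast
  ultimately have "k 0 < real n * c" by (simp add: field_simps)
  moreover have "k n \<le> k 0 - real n * c"
  proof (induction n)
    case (Suc n)
    then show ?case using assms(2)[of n] by (simp add: algebra_simps)
  qed simp
  ultimately show False using assms(1)[of n] by simp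
qed

lemma invertible_opE:
  assumes "invertible_op T"
  obtains S where "bounded_clinear S" "\<And>x. S (T x) = x" "\<And>x. T (S x) = x" "inv T = S"
proof -
  obtain S where S: "bounded_clinear S" "S \<circ> T = id" "T \<circ> S = id"
    using assms by (auto simp: invertible_op_def)
  then have "inv T = S" by (intro inv_unique_comp) auto
  then show thesis using S by (intro that[of S]) (simp_all add: fun_eq_iff)
qed

text \<open>With \<open>k\<^sub>n = \<parallel>T\<^sup>n x\<parallel>\<^sup>2\<close> the hypothesis is
  \<open>k\<^sub>n\<^sub>+\<^sub>2 - k\<^sub>n\<^sub>+\<^sub>1 \<le> r\<^sup>2 (k\<^sub>n\<^sub>+\<^sub>1 - k\<^sub>n)\<close> for all integers \<open>n\<close>. A positive first difference therefore stays
  at least as large when \<open>n\<close> decreases. Equivalently \<open>k\<^sub>n\<^sub>+\<^sub>1 - r\<^sup>2 k\<^sub>n\<close> decreases in \<open>n\<close>, so that a negative value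
  of it stays negative when \<open>n\<close> increases. In both cases \<open>k\<close> loses a fixed amount at each step,
  which a nonnegative sequence cannot do.\<close>

lemma C_alpha_subset_C_1r:
  fixes T :: "'a::chilbert_space \<Rightarrow> 'a"
  assumes r: "0 < r" "r < 1" and T: "T \<in> C_alpha r"
  shows "T \<in> C_1r r"
proof -
  have blT: "bounded_clinear T" and inv: "invertible_op T"
    and alpha: "\<And>x. (norm (T (T x)))\<^sup>2 + r\<^sup>2 * (norm x)\<^sup>2 \<le> (1 + r\<^sup>2) * (norm (T x))\<^sup>2"
    using T by (auto simp: mem_C_alpha_iff)
  from inv obtain S where S: "bounded_clinear S" "\<And>x. S (T x) = x" "\<And>x. T (S x) = x"
    and invT: "inv T = S" using invertible_opE by blast
  have r2: "0 < r\<^sup>2" "r\<^sup>2 < 1" using r by (auto simp: power_less_one_iff)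
  have contr: "(norm (T x))\<^sup>2 \<le> (norm x)\<^sup>2" for x
  proof (rule ccontr)
    \<comment> \<open>the orbit is followed backwards, along \<open>S = T\<^sup>-\<^sup>1\<close>\<close>
    define k where "k = (\<lambda>n. (norm ((S ^^ n) x))\<^sup>2)"
    define c where "c = (norm (T x))\<^sup>2 - (norm x)\<^sup>2"
    assume "\<not> ?thesis"
    then have "0 < c" unfolding c_def by linarith
    have step: "k n - k (Suc n) \<le> r\<^sup>2 * (k (Suc n) - k (Suc (Suc n)))" for n
      using alpha[of "(S ^^ Suc (Suc n)) x"] by (simp add: k_def S algebra_simps)
    have "c \<le> r\<^sup>2 * (k 0 - k (Suc 0))"
      using alpha[of "S x"] by (simp add: c_def k_def S algebra_simps)
    have mono: "c \<le> a" if "c \<le> r\<^sup>2 * a" for a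
    proof -
      have "0 < a" using that \<open>0 < c\<close> r2 by (meson less_le_trans zero_less_mult_pos)
      then have "r\<^sup>2 * a \<le> 1 * a" using r2 by (intro mult_right_mono) auto
      with that show ?thesis by simp
    qed
    have "c \<le> k n - k (Suc n)" for n
    proof (induction n)
      case 0
      from \<open>c \<le> r\<^sup>2 * (k 0 - k (Suc 0))\<close> show ?case by (rule mono)
    next
      case (Suc n)
      then show ?case using mono step order_trans by blast
    qed
    then have "k (Suc n) \<le> k n - c" for n by (smt (verit))
    then have "c \<le> 0" by (rule nonneg_bounded_below_drop[of k, rotated]) (simp add: k_def)
    with \<open>0 < c\<close> show False by simp
  qed
  have below: "r\<^sup>2 * (norm x)\<^sup>2 \<le> (norm (T x))\<^sup>2" for x
  proof -
    define k where "k = (\<lambda>n. (norm ((T ^^ n) x))\<^sup>2)"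
    define c where "c = r\<^sup>2 * (norm x)\<^sup>2 - (norm (T x))\<^sup>2"
    have step: "r\<^sup>2 * k n - k (Suc n) \<le> r\<^sup>2 * k (Suc n) - k (Suc (Suc n))" for n
      using alpha[of "(T ^^ n) x"] by (simp add: k_def algebra_simps)
    have "c \<le> r\<^sup>2 * k n - k (Suc n)" for n
    proof (induction n)
      case (Suc n)
      then show ?case using step order_trans by blast
    qed (simp add: c_def k_def)
    moreover have "r\<^sup>2 * k n \<le> 1 * k n" for n
      using r2 by (intro mult_right_mono) (auto simp: k_def)
    ultimately have "k (Suc n) \<le> k n - c" for n by (smt (verit))
    then have "c \<le> 0" by (rule nonneg_bounded_below_drop[of k, rotated]) (simp add: k_def)
    then show ?thesis by (simp add: c_def)
  qed
  have "onorm T \<le> 1"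
    by (intro onorm_bound) (simp_all add: contr power2_le_imp_le)
  moreover have "onorm S \<le> 1 / r"
  proof (intro onorm_bound)
    fix x
    have "(r * norm (S x))\<^sup>2 \<le> (norm x)\<^sup>2"
      using below[of "S x"] by (simp add: S power_mult_distrib)
    then have "r * norm (S x) \<le> norm x" by (rule power2_le_imp_le) simp
    then show "norm (S x) \<le> 1 / r * norm x" using r by (simp add: field_simps)
  qed (use r in simp)
  ultimately show ?thesis using blT inv by (simp add: C_1r_def invT)
qed

section \<open>Laurent polynomials of an operator with a spectral annulus\<close>

lemma Sp_annulus_invertible:
  assumes "0 < r" "T \<in> Sp_annulus r"
  shows "invertible_op T"
proof -
  have "0 \<notin> spectrum T"
    using assms by (auto simp: Sp_annulus_def one_spectral_def closed_annulus_def)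
  then show ?thesis by (simp add: spectrum_def)
qed

text \<open>The case of the rational function \<open>p / z\<^sup>N\<close>, freed of the inverse: \<open>z\<^sup>N\<close> has no zero in the
  annulus, and every vector has the form \<open>T\<^sup>N x\<close>.\<close>

lemma Sp_annulus_laurent_bound:
  fixes T :: "'a::chilbert_space \<Rightarrow> 'a"
  assumes r: "0 < r" "r < 1" and T: "T \<in> Sp_annulus r"
    and B: "\<And>z. z \<in> closed_annulus r \<Longrightarrow> cmod (poly p z / z ^ N) \<le> B"
  shows "norm (poly_op p T x) \<le> B * norm ((T ^^ N) x)"
proof -
  have blT: "bounded_clinear T" and spec: "one_spectral (closed_annulus r) T"
    using T by (auto simp: Sp_annulus_def)
  obtain S where S: "bounded_clinear S" "\<And>x. S (T x) = x" "\<And>x. T (S x) = x"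
    using invertible_opE[OF Sp_annulus_invertible[OF r(1) T]] by metis
  define q :: "complex poly" where "q = monom 1 N"
  have q0: "\<forall>z\<in>closed_annulus r. poly q z \<noteq> 0"
    using r by (auto simp: q_def poly_monom closed_annulus_def)
  have qT: "poly_op q T = T ^^ N" by (simp add: q_def poly_op_monom fun_eq_iff)
  have "inv (T ^^ N) = S ^^ N"
    using funpow_inverse[of S T N] funpow_inverse[of T S N] S
    by (intro inv_unique_comp) (auto simp: fun_eq_iff)
  then have rat: "rational_op p q T = (\<lambda>y. poly_op p T ((S ^^ N) y))"
    by (simp add: rational_op_def qT comp_def)
  have "onorm (rational_op p q T) \<le> B"
  proof -
    have "1 \<in> closed_annulus r" using r by (simp add: closed_annulus_def)
    then have "(SUP z\<in>closed_annulus r. cmod (poly p z / poly q z)) \<le> B"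
      using B by (intro cSUP_least) (auto simp: q_def poly_monom)
    moreover have "onorm (rational_op p q T)
        \<le> (SUP z\<in>closed_annulus r. cmod (poly p z / poly q z))"
      using spec q0 unfolding one_spectral_def by blast
    ultimately show ?thesis by (rule order_trans[rotated])
  qed
  moreover have "norm (rational_op p q T y) \<le> onorm (rational_op p q T) * norm y" for y
    unfolding rat
    using bounded_clinear_compose[OF bounded_clinear_poly_op[OF blT] bounded_clinear_funpow[OF S(1)]]
    by (intro onorm) (simp add: bounded_clinear_def)
  ultimately have "norm (rational_op p q T y) \<le> B * norm y" for y
    by (meson mult_right_mono norm_ge_zero order_trans)
  from this[of "(T ^^ N) x"] show ?thesis
    using funpow_inverse[of S T N x] S by (simp add: rat fun_eq_iff)
qed

lemma compact_closed_annulus: "compact (closed_annulus r)"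
proof -
  have "closed_annulus r = cball 0 1 \<inter> - ball 0 r"
    by (auto simp: closed_annulus_def)
  then show ?thesis by (auto intro!: compact_Int_closed)
qed

text \<open>If \<open>Re f \<ge> 0\<close> and \<open>\<bar>f\<bar> \<le> B\<close> on the annulus, then \<open>\<bar>1 - \<epsilon> f\<bar>\<^sup>2 \<le> 1 + \<epsilon>\<^sup>2 B\<^sup>2\<close> there. The same
  bound for \<open>1 - \<epsilon> f(T)\<close> gives \<open>- 2 Re \<langle>f(T) u, u\<rangle> \<le> \<epsilon> B\<^sup>2 \<parallel>u\<parallel>\<^sup>2\<close>, and \<open>\<epsilon> \<rightarrow> 0\<close> is left. For a Laurent
  polynomial \<open>f\<close>, the function \<open>1 - \<epsilon> f\<close> is a Laurent polynomial again, as \<open>exp (- f)\<close> and the Cayley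
  transform of \<open>f\<close> are not.\<close>

lemma Sp_annulus_laurent_Re_nonneg:
  fixes T :: "'a::chilbert_space \<Rightarrow> 'a"
  assumes r: "0 < r" "r < 1" and T: "T \<in> Sp_annulus r"
    and pos: "\<And>z. z \<in> closed_annulus r \<Longrightarrow> 0 \<le> Re (poly p z / z ^ N)"
  shows "0 \<le> Re (cinner (poly_op p T x) ((T ^^ N) x))"
proof -
  have "continuous_on (closed_annulus r) (\<lambda>z. poly p z / z ^ N)"
    using r by (intro continuous_intros) (auto simp: closed_annulus_def)
  then have "bounded ((\<lambda>z. poly p z / z ^ N) ` closed_annulus r)"
    by (intro compact_imp_bounded compact_continuous_image compact_closed_annulus)
  then obtain B where B: "\<And>z. z \<in> closed_annulus r \<Longrightarrow> cmod (poly p z / z ^ N) \<le> B"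
    by (auto simp: bounded_iff)
  define u where "u = (T ^^ N) x"
  define v where "v = poly_op p T x"
  have small: "- 2 * inner v u \<le> e * (B\<^sup>2 * (norm u)\<^sup>2)" if "0 < e" for e
  proof -
    define q where "q = monom 1 N + smult (complex_of_real (- e)) p"
    have "cmod (poly q z / z ^ N) \<le> sqrt (1 + e\<^sup>2 * B\<^sup>2)" if z: "z \<in> closed_annulus r" for z
    proof (rule real_le_rsqrt)
      define f where "f = poly p z / z ^ N"
      have "z \<noteq> 0" using z r by (auto simp: closed_annulus_def)
      then have "poly q z / z ^ N = 1 - of_real e * f"
        by (simp add: q_def f_def poly_monom field_simps)
      then have "(cmod (poly q z / z ^ N))\<^sup>2 = 1 - 2 * e * Re f + e\<^sup>2 * (cmod f)\<^sup>2"
        by (simp only: cmod_power2) (simp add: power2_eq_square algebra_simps)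
      moreover have "0 \<le> e * Re f" using pos[OF z] \<open>0 < e\<close> by (simp add: f_def)
      moreover have "e\<^sup>2 * (cmod f)\<^sup>2 \<le> e\<^sup>2 * B\<^sup>2"
        using B[OF z] by (intro mult_left_mono power_mono) (auto simp: f_def)
      ultimately show "(cmod (poly q z / z ^ N))\<^sup>2 \<le> 1 + e\<^sup>2 * B\<^sup>2" by linarith
    qed
    from Sp_annulus_laurent_bound[OF r T this, of x]
    have "norm (u - e *\<^sub>R v) \<le> sqrt (1 + e\<^sup>2 * B\<^sup>2) * norm u"
      using scaleC_of_real[of "- e" v]
      by (simp add: q_def poly_op_add poly_op_smult poly_op_monom u_def v_def del: of_real_minus)
    then have "(norm (u - e *\<^sub>R v))\<^sup>2 \<le> (1 + e\<^sup>2 * B\<^sup>2) * (norm u)\<^sup>2"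
      using power_mono[of "norm (u - e *\<^sub>R v)" _ 2] by (fastforce simp: power_mult_distrib)
    moreover have "(norm (u - e *\<^sub>R v))\<^sup>2 = (norm u)\<^sup>2 - 2 * e * inner v u + e\<^sup>2 * (norm v)\<^sup>2"
      unfolding power2_norm_eq_inner
      by (simp add: inner_diff inner_commute power2_eq_square algebra_simps)
    moreover have "0 \<le> e\<^sup>2 * (norm v)\<^sup>2" by simp
    ultimately have "e * (- 2 * inner v u) \<le> e * (e * (B\<^sup>2 * (norm u)\<^sup>2))"
      by (simp add: power2_eq_square algebra_simps)
    then show ?thesis using \<open>0 < e\<close> by (simp only: mult_le_cancel_left_pos)
  qed
  have "((\<lambda>e. e * (B\<^sup>2 * (norm u)\<^sup>2)) \<longlongrightarrow> 0 * (B\<^sup>2 * (norm u)\<^sup>2)) (at_right 0)"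
    by (intro tendsto_intros)
  then have "- 2 * inner v u \<le> 0 * (B\<^sup>2 * (norm u)\<^sup>2)"
    by (rule tendsto_lowerbound)
       (use small in \<open>auto intro: eventually_mono[OF eventually_at_right_less[of 0]]\<close>)
  then show ?thesis by (simp add: u_def v_def inner_eq_Re_cinner)
qed

section \<open>A positive harmonic function on the annulus\<close>

text \<open>The sum and its conjugate differ by the exchange of \<open>k\<close> and \<open>l\<close>. So only the symmetric part of
  the coefficients contributes to the real part. For \<open>\<bar>z\<bar> = 1\<close> the value is \<open>N\<close> times the
  Fejer kernel.\<close>

lemma Re_hermitian_sum:
  fixes a :: "nat \<Rightarrow> nat \<Rightarrow> real" and z :: complex
  assumes a: "\<And>k l. a k l + a l k = 2"
  shows "Re (\<Sum>k<N. \<Sum>l<N. of_real (a k l) * (z ^ k * cnj z ^ l)) = (cmod (\<Sum>k<N. z ^ k))\<^sup>2"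
proof -
  define X where "X = (\<Sum>k<N. \<Sum>l<N. of_real (a k l) * (z ^ k * cnj z ^ l))"
  have "cnj X = (\<Sum>k<N. \<Sum>l<N. of_real (a k l) * (z ^ l * cnj z ^ k))"
    by (simp add: X_def mult.commute)
  also have "\<dots> = (\<Sum>k<N. \<Sum>l<N. of_real (a l k) * (z ^ k * cnj z ^ l))"
    by (rule sum.swap)
  finally have "X + cnj X = (\<Sum>k<N. \<Sum>l<N. of_real (a k l + a l k) * (z ^ k * cnj z ^ l))"
    by (simp add: X_def sum.distrib distrib_right)
  also have "\<dots> = 2 * ((\<Sum>k<N. z ^ k) * (\<Sum>l<N. cnj z ^ l))"
    unfolding a sum_product by (simp only: sum_distrib_left of_real_numeral)
  also have "(\<Sum>l<N. cnj z ^ l) = cnj (\<Sum>k<N. z ^ k)" by simp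
  also have "2 * ((\<Sum>k<N. z ^ k) * cnj (\<Sum>k<N. z ^ k)) = of_real (2 * (cmod (\<Sum>k<N. z ^ k))\<^sup>2)"
    by (simp only: complex_norm_square of_real_mult) simp
  finally have "2 * Re X = 2 * (cmod (\<Sum>k<N. z ^ k))\<^sup>2"
    by (simp only: complex_add_cnj of_real_eq_iff)
  then show ?thesis by (simp add: X_def)
qed

text \<open>This is the Laurent coefficient \<open>2 / (1 + r\<^sup>k\<^sup>-\<^sup>l)\<close>, written without negative exponents.\<close>

definition annulus_coeff :: "real \<Rightarrow> nat \<Rightarrow> nat \<Rightarrow> real" where
  "annulus_coeff r k l = 2 * r ^ l / (r ^ k + r ^ l)"

text \<open>On each of the two boundary circles the coefficients of \<open>(z / \<bar>z\<bar>)\<^sup>k\<^sup>-\<^sup>l\<close> satisfy the symmetry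
  condition of \<open>Re_hermitian_sum\<close>: on the unit circle because \<open>2 / (1 + r\<^sup>n)\<close> and \<open>2 / (1 + r\<^sup>-\<^sup>n)\<close> add up
  to \<open>2\<close>, and on the inner circle because the factor \<open>r\<^sup>n\<close> exchanges these two numbers. The
  maximum principle carries the sign into the annulus. Up to the factor \<open>N\<close>, the function is the
  Fejer mean of \<open>\<Sum>n. 2 z\<^sup>n / (1 + r\<^sup>n)\<close>.\<close>

lemma annulus_fejer_Re_nonneg:
  assumes r: "0 < r" "r < 1" and z: "z \<in> closed_annulus r"
  shows "0 \<le> Re (\<Sum>k<N. \<Sum>l<N. of_real (annulus_coeff r k l) * (z ^ k / z ^ l))"
proof -
  define f where "f z = (\<Sum>k<N. \<Sum>l<N. of_real (annulus_coeff r k l) * (z ^ k / z ^ l))" for z :: complex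
  have nz: "z \<noteq> 0" if "z \<in> closed_annulus r" for z
    using that r by (auto simp: closed_annulus_def)
  have circle: "0 \<le> Re (f z)"
    if s: "cmod z = s" "0 < s"
      and a: "\<And>k l. annulus_coeff r k l * (s ^ k / s ^ l) + annulus_coeff r l k * (s ^ l / s ^ k) = 2"
    for s z
  proof -
    define w where "w = z / of_real s"
    have "z = of_real s * w" and "cmod w = 1" using s by (auto simp: w_def norm_divide)
    then have "w * cnj w = 1" using complex_norm_square[of w] by simp
    then have w: "inverse w = cnj w" "w \<noteq> 0" by (auto intro: inverse_unique)
    have "z ^ k / z ^ l = of_real (s ^ k / s ^ l) * (w ^ k * cnj w ^ l)" for k l
      unfolding w(1)[symmetric] \<open>z = of_real s * w\<close> using s w(2)
      by (simp add: power_mult_distrib power_inverse divide_inverse mult_ac)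
    then have "f z = (\<Sum>k<N. \<Sum>l<N. of_real (annulus_coeff r k l * (s ^ k / s ^ l)) * (w ^ k * cnj w ^ l))"
      by (simp add: f_def mult.assoc)
    then show ?thesis by (simp only: Re_hermitian_sum[OF a]) simp
  qed
  have bd: "0 \<le> Re (f z)" if "z \<in> frontier (closed_annulus r)" for z
  proof -
    have "{z. r < cmod z \<and> cmod z < 1} \<subseteq> interior (closed_annulus r)"
      by (intro interior_maximal open_Collect_conj open_Collect_less continuous_intros)
         (auto simp: closed_annulus_def)
    moreover have "closure (closed_annulus r) = closed_annulus r"
      by (simp add: compact_closed_annulus compact_imp_closed)
    ultimately have "z \<in> closed_annulus r" "\<not> (r < cmod z \<and> cmod z < 1)"
      using that unfolding frontier_def by blast+
    then have "cmod z = 1 \<or> cmod z = r" by (auto simp: closed_annulus_def)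
    moreover have "annulus_coeff r k l * (1 ^ k / 1 ^ l) + annulus_coeff r l k * (1 ^ l / 1 ^ k) = 2"
      "annulus_coeff r k l * (r ^ k / r ^ l) + annulus_coeff r l k * (r ^ l / r ^ k) = 2" for k l
    proof -
      have pos: "0 < r ^ k" "0 < r ^ l" using r by auto
      have frac: "2 * b / (a + b) + 2 * a / (b + a) = 2"
        "2 * b / (a + b) * (a / b) + 2 * a / (b + a) * (b / a) = 2"
        if "0 < a" "0 < b" for a b :: real
      proof -
        have "a + b \<noteq> 0" using that by simp
        then show "2 * b / (a + b) + 2 * a / (b + a) = 2"
          "2 * b / (a + b) * (a / b) + 2 * a / (b + a) * (b / a) = 2"
          using that by (simp_all add: add.commute[of b a] divide_simps)
      qed
      show "annulus_coeff r k l * (1 ^ k / 1 ^ l) + annulus_coeff r l k * (1 ^ l / 1 ^ k) = 2"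
        "annulus_coeff r k l * (r ^ k / r ^ l) + annulus_coeff r l k * (r ^ l / r ^ k) = 2"
        using frac[OF pos] by (simp_all only: annulus_coeff_def power_one div_by_1 mult_1_right)
    qed
    ultimately show ?thesis using circle[of z 1] circle[of z r] r by auto
  qed
  have "Re (- f z) \<le> 0"
  proof (rule maximum_real_frontier[OF _ _ _ _ z])
    show "(\<lambda>z. - f z) holomorphic_on interior (closed_annulus r)"
      unfolding f_def using nz interior_subset[of "closed_annulus r"]
      by (intro holomorphic_intros) auto
    show "continuous_on (closure (closed_annulus r)) (\<lambda>z. - f z)"
      unfolding f_def using nz
      by (intro continuous_intros) (auto simp: compact_closed_annulus compact_imp_closed)
  qed (use bd in \<open>auto simp: compact_closed_annulus compact_imp_bounded\<close>)
  then show ?thesis by (simp add: f_def)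
qed

section \<open>Averaging over rotations\<close>

lemma roots_of_unity_orthogonal:
  assumes "a < M" "b < M"
  defines "\<omega> \<equiv> exp (2 * of_real pi * \<i> / of_nat M)"
  shows "(\<Sum>m<M. (\<omega> ^ m) ^ a * cnj (\<omega> ^ m) ^ b) = (if a = b then of_nat M else 0)"
proof -
  have pow: "\<omega> ^ n = exp (2 * of_real pi * \<i> * of_nat n / of_nat M)" for n
    by (simp add: \<omega>_def flip: exp_of_nat_mult) (simp add: mult_ac)
  have cn: "\<omega> * cnj \<omega> = 1"
    by (simp add: \<omega>_def exp_cnj flip: exp_add)
  define q where "q = \<omega> ^ a * cnj \<omega> ^ b"
  have eq: "(\<omega> ^ m) ^ a * cnj (\<omega> ^ m) ^ b = q ^ m" for m
    by (simp add: q_def power_mult_distrib mult.commute flip: power_mult)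
  have "\<omega> ^ M = 1" using assms(1) complex_root_unity[of M 1] by (simp add: \<omega>_def)
  moreover have "q ^ M = (\<omega> ^ M) ^ a * cnj (\<omega> ^ M) ^ b"
    by (simp add: q_def power_mult_distrib mult.commute flip: power_mult)
  ultimately have "q ^ M = 1" by simp
  have "q = 1 \<longleftrightarrow> a = b"
  proof
    assume "q = 1"
    have "\<omega> ^ b * q = \<omega> ^ a * (\<omega> * cnj \<omega>) ^ b"
      by (simp add: q_def power_mult_distrib)
    with \<open>q = 1\<close> have "\<omega> ^ b = \<omega> ^ a" by (simp add: cn)
    then show "a = b" unfolding pow using complex_root_unity_eq[of M b a] assms by simp
  next
    assume "a = b"
    then show "q = 1" by (simp add: q_def cn flip: power_mult_distrib)
  qed
  with \<open>q ^ M = 1\<close> show ?thesis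
    unfolding eq by (auto simp: sum_gp_strict)
qed

lemma sum_diagonal_shift:
  fixes C :: real
  assumes "\<And>k l. k + i = l + j \<Longrightarrow> c k l = C"
  shows "(\<Sum>k<N. \<Sum>l<N. if k + i = l + j then c k l else 0)
    = real (N - (i - j) - (j - i)) * C"
proof -
  have shift: "(\<Sum>k<N. \<Sum>l<N. if l = k + d then C else 0) = real (N - d) * C" for d
  proof -
    have "(\<Sum>l<N. if l = k + d then C else 0) = (if k < N - d then C else 0)" for k
      by (auto simp: sum.delta)
    then have "(\<Sum>k<N. \<Sum>l<N. if l = k + d then C else 0) = (\<Sum>k<N. if k < N - d then C else 0)"
      by simp
    also have "\<dots> = (\<Sum>k\<in>{..<N - d}. C)"
      by (rule sum.mono_neutral_cong_right) auto
    finally show ?thesis by simp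
  qed
  have "(\<Sum>k<N. \<Sum>l<N. if k + i = l + j then c k l else 0)
      = (\<Sum>k<N. \<Sum>l<N. if k + i = l + j then C else 0)"
    by (intro sum.cong refl) (auto simp: assms)
  also have "\<dots> = real (N - (i - j) - (j - i)) * C"
  proof (cases "j \<le> i")
    case True
    then have "k + i = l + j \<longleftrightarrow> l = k + (i - j)" for k l by auto
    with True shift[of "i - j"] show ?thesis by simp
  next
    case False
    then have "k + i = l + j \<longleftrightarrow> k = l + (j - i)" for k l by auto
    then have "(\<Sum>k<N. \<Sum>l<N. if k + i = l + j then C else 0)
        = (\<Sum>l<N. \<Sum>k<N. if k = l + (j - i) then C else 0)"
      by (subst sum.swap) simp
    with False shift[of "j - i"] show ?thesis by simp
  qed
  finally show ?thesis .
qed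

text \<open>For \<open>\<bar>\<omega>\<bar> = 1\<close> let \<open>u = \<Sum>i<d. w\<^sub>i (\<omega> T)\<^sup>i y\<close>, and let \<open>F\<close> be the function of
  \<open>annulus_fejer_Re_nonneg\<close>. Then \<open>\<langle>F(\<omega> T) u, u\<rangle>\<close> has nonnegative real part. It is a sum of multiples of
  \<open>\<langle>T\<^sup>k\<^sup>-\<^sup>l\<^sup>+\<^sup>i y, T\<^sup>j y\<rangle>\<close>, and the mean over sufficiently many roots of unity \<open>\<omega>\<close> keeps exactly the terms
  with \<open>k - l + i = j\<close>. There are \<open>max 0 (N - \<bar>i - j\<bar>)\<close> such pairs \<open>(k, l)\<close>.\<close>

lemma Sp_annulus_averaged:
  fixes T :: "'a::chilbert_space \<Rightarrow> 'a" and w :: "nat \<Rightarrow> real"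
  assumes r: "0 < r" "r < 1" and T: "T \<in> Sp_annulus r"
  shows "0 \<le> (\<Sum>i<d. \<Sum>j<d. w i * w j * (norm ((T ^^ j) y))\<^sup>2 *
    (real (N - (i - j) - (j - i)) * (2 * r ^ i / (r ^ i + r ^ j))))"
proof (cases "N = 0")
  case False
  have blT: "bounded_clinear T" using T by (simp add: Sp_annulus_def)
  obtain S where S: "bounded_clinear S" "\<And>x. S (T x) = x" "\<And>x. T (S x) = x"
    using invertible_opE[OF Sp_annulus_invertible[OF r(1) T]] by metis
  \<comment> \<open>\<open>e n\<close> is \<open>T\<^sup>n\<^sup>-\<^sup>N y\<close>: the shift by \<open>N\<close> makes all exponents natural numbers\<close>
  define e where "e n = (T ^^ n) ((S ^^ N) y)" for n
  have e_add: "(T ^^ m) (e n) = e (m + n)" for m n by (simp add: e_def funpow_add)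
  have eN: "e (N + j) = (T ^^ j) y" for j
    using funpow_inverse[of T S N y] S
    by (simp add: e_def fun_eq_iff add.commute[of N] funpow_add)
  define A where "A k l i j =
      of_real (annulus_coeff r k l * w i * w j) * cinner (e (N + k - l + i)) (e (N + j))"
    for k l i j
  have pos: "0 \<le> Re (\<Sum>k<N. \<Sum>l<N. \<Sum>i<d. \<Sum>j<d. A k l i j * (\<omega> ^ (k + i) * cnj \<omega> ^ (l + j)))"
    if \<omega>: "cmod \<omega> = 1" for \<omega>
  proof -
    define X where "X = (\<Sum>i<d. (of_real (w i) * \<omega> ^ i) *\<^sub>C e i)"
    define P where "P = (\<Sum>k<N. \<Sum>l<N.
      monom (of_real (annulus_coeff r k l) * (\<omega> ^ k * cnj \<omega> ^ l)) (N + k - l))"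
    have \<omega>0: "\<omega> \<noteq> 0" "cnj \<omega> = inverse \<omega>"
      using \<omega> complex_norm_square[of \<omega>] by (auto intro: inverse_unique[symmetric])
    have "0 \<le> Re (poly P z / z ^ N)" if z: "z \<in> closed_annulus r" for z
    proof -
      have "z \<noteq> 0" using z r by (auto simp: closed_annulus_def)
      have "z ^ (N + k - l) / z ^ N = z ^ k / z ^ l" if "l < N" for k l
        using \<open>z \<noteq> 0\<close> that by (simp add: field_simps flip: power_add)
      then have "poly P z / z ^ N = (\<Sum>k<N. \<Sum>l<N. of_real (annulus_coeff r k l) * ((\<omega> * z) ^ k / (\<omega> * z) ^ l))"
        unfolding P_def poly_sum poly_monom sum_divide_distrib times_divide_eq_right[symmetric]
        using \<omega>0 by (intro sum.cong refl)
          (simp add: power_mult_distrib power_inverse divide_inverse mult_ac)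
      moreover have "\<omega> * z \<in> closed_annulus r"
        using z \<omega> by (simp add: closed_annulus_def norm_mult)
      ultimately show ?thesis using annulus_fejer_Re_nonneg[OF r] by simp
    qed
    from Sp_annulus_laurent_Re_nonneg[OF r T this, of X]
    have "0 \<le> Re (cinner (poly_op P T X) ((T ^^ N) X))" .
    moreover have TX: "(T ^^ n) X = (\<Sum>i<d. (of_real (w i) * \<omega> ^ i) *\<^sub>C e (n + i))" for n
      by (simp add: X_def clinear_sum[OF bounded_clinear_funpow[OF blT]] e_add)
    have "cinner (poly_op P T X) ((T ^^ N) X)
        = (\<Sum>k<N. \<Sum>l<N. \<Sum>i<d. \<Sum>j<d. A k l i j * (\<omega> ^ (k + i) * cnj \<omega> ^ (l + j)))"
      unfolding P_def poly_op_sum poly_op_monom TX scaleC_sum_right scaleC_scaleC cinner_sum_left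
      unfolding cinner_sum_right cinner_scaleC_left cinner_scaleC_right
      by (intro sum.cong refl) (simp add: A_def power_add mult_ac)
    ultimately show ?thesis by simp
  qed
  \<comment> \<open>the exponents \<open>k + i\<close> and \<open>l + j\<close> are below \<open>N + d\<close>, so that no two are congruent\<close>
  define M where "M = N + d"
  define \<omega> where "\<omega> = exp (2 * of_real pi * \<i> / of_nat M)"
  have "cmod (\<omega> ^ m) = 1" for m by (simp add: \<omega>_def norm_power norm_exp_eq_Re)
  then have "0 \<le> (\<Sum>m<M. Re (\<Sum>k<N. \<Sum>l<N. \<Sum>i<d. \<Sum>j<d.
      A k l i j * ((\<omega> ^ m) ^ (k + i) * cnj (\<omega> ^ m) ^ (l + j))))"
    by (intro sum_nonneg pos)
  also have "\<dots> = Re (\<Sum>m<M. \<Sum>k<N. \<Sum>l<N. \<Sum>i<d. \<Sum>j<d.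
      A k l i j * ((\<omega> ^ m) ^ (k + i) * cnj (\<omega> ^ m) ^ (l + j)))"
    by simp
  also have "(\<Sum>m<M. \<Sum>k<N. \<Sum>l<N. \<Sum>i<d. \<Sum>j<d.
      A k l i j * ((\<omega> ^ m) ^ (k + i) * cnj (\<omega> ^ m) ^ (l + j)))
      = (\<Sum>k<N. \<Sum>l<N. \<Sum>i<d. \<Sum>j<d.
          A k l i j * (\<Sum>m<M. (\<omega> ^ m) ^ (k + i) * cnj (\<omega> ^ m) ^ (l + j)))"
    unfolding sum_distrib_left
    by (subst sum.swap, rule sum.cong[OF refl])+ (rule refl)
  also have "\<dots> = (\<Sum>k<N. \<Sum>l<N. \<Sum>i<d. \<Sum>j<d. if k + i = l + j then
      of_real (real M * (annulus_coeff r k l * w i * w j * (norm ((T ^^ j) y))\<^sup>2)) else 0)"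
  proof (intro sum.cong refl)
    fix k l i j assume "k \<in> {..<N}" "l \<in> {..<N}" "i \<in> {..<d}" "j \<in> {..<d}"
    then have kl: "k + i < M" "l + j < M" "l < N" by (auto simp: M_def)
    have "A k l i j = of_real (annulus_coeff r k l * w i * w j * (norm ((T ^^ j) y))\<^sup>2)"
      if "k + i = l + j"
    proof -
      have "N + k - l + i = N + j" using that kl by simp
      then show ?thesis by (simp add: A_def cinner_self eN)
    qed
    then show "A k l i j * (\<Sum>m<M. (\<omega> ^ m) ^ (k + i) * cnj (\<omega> ^ m) ^ (l + j)) = (if k + i = l + j then
      of_real (real M * (annulus_coeff r k l * w i * w j * (norm ((T ^^ j) y))\<^sup>2)) else 0)"
      unfolding \<omega>_def roots_of_unity_orthogonal[OF kl(1,2)] by simp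
  qed
  also have "Re \<dots> = (\<Sum>k<N. \<Sum>l<N. \<Sum>i<d. \<Sum>j<d. if k + i = l + j then
      real M * (annulus_coeff r k l * w i * w j * (norm ((T ^^ j) y))\<^sup>2) else 0)"
    by (simp add: if_distrib[of Re] cong: if_cong)
  also have "\<dots> = (\<Sum>i<d. \<Sum>j<d. \<Sum>k<N. \<Sum>l<N. if k + i = l + j then
      real M * (annulus_coeff r k l * w i * w j * (norm ((T ^^ j) y))\<^sup>2) else 0)"
    by (simp only: sum.swap[of _ "{..<d}" "{..<N}"])
  also have "\<dots> = (\<Sum>i<d. \<Sum>j<d. real M * (w i * w j * (norm ((T ^^ j) y))\<^sup>2) *
      (\<Sum>k<N. \<Sum>l<N. if k + i = l + j then annulus_coeff r k l else 0))"
    unfolding sum_distrib_left by (intro sum.cong refl) simp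
  also have "\<dots> = (\<Sum>i<d. \<Sum>j<d. real M * (w i * w j * (norm ((T ^^ j) y))\<^sup>2) *
      (real (N - (i - j) - (j - i)) * (2 * r ^ i / (r ^ i + r ^ j))))"
  proof (intro sum.cong refl arg_cong2[of _ _ _ _ "(*)"] sum_diagonal_shift)
    fix i j k l :: nat
    assume "k + i = l + j"
    then have "r ^ k * r ^ i = r ^ l * r ^ j" by (simp flip: power_add)
    moreover have "r ^ k + r ^ l \<noteq> 0" "r ^ i + r ^ j \<noteq> 0"
      using r by (metis add_pos_pos less_irrefl zero_less_power)+
    ultimately show "annulus_coeff r k l = 2 * r ^ i / (r ^ i + r ^ j)"
      by (simp add: annulus_coeff_def frac_eq_eq algebra_simps)
  qed
  also have "\<dots> = real M * (\<Sum>i<d. \<Sum>j<d. w i * w j * (norm ((T ^^ j) y))\<^sup>2 *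
      (real (N - (i - j) - (j - i)) * (2 * r ^ i / (r ^ i + r ^ j))))"
    by (simp add: sum_distrib_left mult.assoc)
  finally show ?thesis using False by (simp add: M_def zero_le_mult_iff)
qed simp

text \<open>Dividing by \<open>N\<close> removes the Fejer weights in the limit. The form belongs to the unbounded
  function \<open>\<Sum>n. 2 z\<^sup>n / (1 + r\<^sup>n)\<close>, to which the spectral set condition does not apply directly.\<close>

lemma Sp_annulus_moment_form_nonneg:
  fixes T :: "'a::chilbert_space \<Rightarrow> 'a" and w :: "nat \<Rightarrow> real"
  assumes r: "0 < r" "r < 1" and T: "T \<in> Sp_annulus r"
  shows "0 \<le> (\<Sum>i<d. \<Sum>j<d. w i * w j * (norm ((T ^^ j) y))\<^sup>2 * (2 * r ^ i / (r ^ i + r ^ j)))"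
proof (rule tendsto_lowerbound)
  have lim: "(\<lambda>N. real (N - a) / real N) \<longlonglongrightarrow> 1" for a
  proof -
    have "(\<lambda>N. 1 - real a / real N) \<longlonglongrightarrow> 1 - 0"
      by (intro tendsto_intros lim_const_over_n)
    moreover have "\<forall>\<^sub>F N in sequentially. 1 - real a / real N = real (N - a) / real N"
      using eventually_ge_at_top[of "Suc a"]
      by eventually_elim (simp add: of_nat_diff field_simps)
    ultimately show ?thesis by (auto intro: Lim_transform_eventually)
  qed
  show "(\<lambda>N. \<Sum>i<d. \<Sum>j<d. w i * w j * (norm ((T ^^ j) y))\<^sup>2 *
      (real (N - ((i - j) + (j - i))) / real N * (2 * r ^ i / (r ^ i + r ^ j))))
      \<longlonglongrightarrow> (\<Sum>i<d. \<Sum>j<d. w i * w j * (norm ((T ^^ j) y))\<^sup>2 * (2 * r ^ i / (r ^ i + r ^ j)))"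
    by (intro tendsto_sum tendsto_mult_left)
       (auto intro: tendsto_mult_right[OF lim, of _ "2 * r ^ i / (r ^ i + r ^ j)" for i j, simplified])
  have "0 \<le> (\<Sum>i<d. \<Sum>j<d. w i * w j * (norm ((T ^^ j) y))\<^sup>2 *
    (real (N - (i - j) - (j - i)) * (2 * r ^ i / (r ^ i + r ^ j)))) / real N" for N
    by (intro divide_nonneg_nonneg Sp_annulus_averaged[OF r T]) simp
  moreover have "(\<Sum>i<d. \<Sum>j<d. w i * w j * (norm ((T ^^ j) y))\<^sup>2 *
      (real (N - (i - j) - (j - i)) * (2 * r ^ i / (r ^ i + r ^ j)))) / real N
      = (\<Sum>i<d. \<Sum>j<d. w i * w j * (norm ((T ^^ j) y))\<^sup>2 *
      (real (N - ((i - j) + (j - i))) / real N * (2 * r ^ i / (r ^ i + r ^ j))))" for N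
    unfolding sum_divide_distrib by (intro sum.cong refl) (simp add: mult_ac)
  ultimately show "\<forall>\<^sub>F N in sequentially. 0 \<le> (\<Sum>i<d. \<Sum>j<d. w i * w j * (norm ((T ^^ j) y))\<^sup>2 *
      (real (N - ((i - j) + (j - i))) / real N * (2 * r ^ i / (r ^ i + r ^ j))))"
    by simp
qed simp

lemma Sp_annulus_subset_C_alpha:
  fixes T :: "'a::chilbert_space \<Rightarrow> 'a"
  assumes r: "0 < r" "r < 1" and T: "T \<in> Sp_annulus r"
  shows "T \<in> C_alpha r"
proof -
  have "(norm (T (T x)))\<^sup>2 + r\<^sup>2 * (norm x)\<^sup>2 \<le> (1 + r\<^sup>2) * (norm (T x))\<^sup>2" for x
  proof -
    \<comment> \<open>the coefficients of \<open>(1 - z) (r - z)\<close>; they annihilate the form of every normal operator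
      with spectrum on the two boundary circles\<close>
    define w where "w i = (if i = 0 then r else if i = 1 then - (1 + r) else 1)" for i :: nat
    define k where "k j = (norm ((T ^^ j) x))\<^sup>2" for j
    have "(\<Sum>i<3. \<Sum>j<3. w i * w j * k j * (2 * r ^ i / (r ^ i + r ^ j)))
        = (1 - r)\<^sup>2 / (1 + r\<^sup>2) * ((1 + r\<^sup>2) * k 1 - k 2 - r\<^sup>2 * k 0)"
    proof -
      \<comment> \<open>\<open>u\<close> and \<open>v\<close> keep the denominators out of the polynomial identities below\<close>
      define u where "u = 2 / (1 + r)"
      define v where "v = 1 / (1 + r\<^sup>2)"
      have "1 + r\<^sup>2 \<noteq> 0" by (metis add_pos_nonneg less_irrefl zero_le_power2 zero_less_one)
      moreover have "1 + r \<noteq> 0" using r by simp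
      ultimately have u: "(1 + r) * u = 2" and v: "(1 + r\<^sup>2) * v = 1"
        by (simp_all only: u_def v_def times_divide_eq_right mult_1_right mult.commute[of _ 2]
            nonzero_mult_div_cancel_right divide_self simp_thms)
      have sum3: "(\<Sum>i<3. f i) = f 0 + f 1 + f 2" for f :: "nat \<Rightarrow> real"
        by (simp add: eval_nat_numeral)
      have w: "w 0 = r" "w 1 = - (1 + r)" "w 2 = 1" by (simp_all add: w_def)
      define g where "g i j = 2 * r ^ i / (r ^ i + r ^ j)" for i j :: nat
      have g: "g 0 0 = 1" "g 1 1 = 1" "g 2 2 = 1" "g 0 1 = u" "g 1 0 = r * u" "g 1 2 = u"
        "g 2 1 = r * u" "g 0 2 = 2 * v" "g 2 0 = 2 * r\<^sup>2 * v"
      proof -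
        have eq: "r + r\<^sup>2 = r * (1 + r)" "r\<^sup>2 + r = r * (1 + r)" "r\<^sup>2 = r * r"
          by (simp_all add: power2_eq_square algebra_simps)
        show "g 1 2 = u" "g 2 1 = r * u"
          unfolding g_def u_def power_one_right eq(1,2) using r by (simp_all add: eq(3))
      qed (use r in \<open>simp_all add: g_def u_def v_def add.commute\<close>)
      have "(\<Sum>i<3. \<Sum>j<3. w i * w j * k j * (2 * r ^ i / (r ^ i + r ^ j)))
          = r\<^sup>2 * k 0 + (1 + r)\<^sup>2 * k 1 + k 2 - r * ((1 + r) * u) * (k 1 + r * k 0)
            - (1 + r) * u * (k 2 + r * k 1) + 2 * r * v * (k 2 + r\<^sup>2 * k 0)"
        unfolding g_def[symmetric] sum3 w g by (simp add: power2_eq_square algebra_simps)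
      also have "\<dots> = (1 - r)\<^sup>2 * k 1 - (r\<^sup>2 * k 0 + k 2) * ((1 + r\<^sup>2) * v - 2 * r * v)"
        unfolding u v by (simp add: power2_eq_square algebra_simps)
      also have "\<dots> = (1 - r)\<^sup>2 * (1 * k 1 - v * (k 2 + r\<^sup>2 * k 0))"
        by (simp add: power2_eq_square algebra_simps)
      also have "\<dots> = (1 - r)\<^sup>2 * ((1 + r\<^sup>2) * v * k 1 - v * (k 2 + r\<^sup>2 * k 0))"
        by (simp only: v)
      also have "\<dots> = (1 - r)\<^sup>2 * v * ((1 + r\<^sup>2) * k 1 - k 2 - r\<^sup>2 * k 0)"
        by (simp add: algebra_simps)
      finally show ?thesis by (simp add: v_def)
    qed
    moreover have "0 \<le> (\<Sum>i<3. \<Sum>j<3. w i * w j * k j * (2 * r ^ i / (r ^ i + r ^ j)))"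
      unfolding k_def by (rule Sp_annulus_moment_form_nonneg[OF r T])
    moreover have "0 < (1 - r)\<^sup>2 / (1 + r\<^sup>2)"
      using r by (auto intro!: divide_pos_pos add_pos_nonneg)
    ultimately have "0 \<le> (1 + r\<^sup>2) * k 1 - k 2 - r\<^sup>2 * k 0"
      by (simp only: zero_le_mult_iff) simp
    then show ?thesis by (simp add: k_def numeral_2_eq_2)
  qed
  then show ?thesis
    using T Sp_annulus_invertible[OF r(1) T] by (auto simp: mem_C_alpha_iff Sp_annulus_def)
qed

section \<open>Operators exchanging two coordinates\<close>

definition swap_fun :: "complex \<Rightarrow> complex \<Rightarrow> (nat \<Rightarrow> complex) \<Rightarrow> nat \<Rightarrow> complex" where
  "swap_fun a b x n = (if n = 0 then a * x 1 else if n = 1 then b * x 0 else x n)"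

lemma swap_fun_summable:
  assumes "summable (\<lambda>n. (cmod (x n))\<^sup>2)"
  shows "summable (\<lambda>n. (cmod (swap_fun a b x n))\<^sup>2)"
  using assms summable_iff_shift[of "\<lambda>n. (cmod (x n))\<^sup>2" 2]
    summable_iff_shift[of "\<lambda>n. (cmod (swap_fun a b x n))\<^sup>2" 2]
  by (simp add: swap_fun_def)

lift_definition swap_op :: "complex \<Rightarrow> complex \<Rightarrow> ell2 \<Rightarrow> ell2" is swap_fun
  by (rule swap_fun_summable)

lemma swap_op_nth: "ell2_nth (swap_op a b x) n =
    (if n = 0 then a * ell2_nth x 1 else if n = 1 then b * ell2_nth x 0 else ell2_nth x n)"
  by (simp add: swap_op.rep_eq swap_fun_def)

lemma norm_ell2_split:
  "(norm x)\<^sup>2 = (cmod (ell2_nth x 0))\<^sup>2 + (cmod (ell2_nth x 1))\<^sup>2 + (\<Sum>n. (cmod (ell2_nth x (n + 2)))\<^sup>2)"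
  unfolding norm_ell2_sq
  by (subst suminf_split_initial_segment[OF ell2_summable, of _ 2]) (simp add: eval_nat_numeral)

lemma norm_swap_op: "(norm (swap_op a b x))\<^sup>2 = (norm x)\<^sup>2
    + ((cmod b)\<^sup>2 - 1) * (cmod (ell2_nth x 0))\<^sup>2 + ((cmod a)\<^sup>2 - 1) * (cmod (ell2_nth x 1))\<^sup>2"
  by (simp add: norm_ell2_split swap_op_nth norm_mult power_mult_distrib algebra_simps)

lemma norm_swap_op_le:
  assumes "cmod a \<le> K" "cmod b \<le> K" "1 \<le> K"
  shows "norm (swap_op a b x) \<le> K * norm x"
proof (rule power2_le_imp_le)
  define R where "R = (\<Sum>n. (cmod (ell2_nth x (n + 2)))\<^sup>2)"
  have "0 \<le> R"
    unfolding R_def by (intro suminf_nonneg summable_ignore_initial_segment ell2_summable) simp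
  have "(norm (swap_op a b x))\<^sup>2
      = (cmod b)\<^sup>2 * (cmod (ell2_nth x 0))\<^sup>2 + (cmod a)\<^sup>2 * (cmod (ell2_nth x 1))\<^sup>2 + 1\<^sup>2 * R"
    unfolding norm_ell2_split[of "swap_op a b x"] R_def
    by (simp add: swap_op_nth norm_mult power_mult_distrib)
  also have "\<dots> \<le> K\<^sup>2 * (cmod (ell2_nth x 0))\<^sup>2 + K\<^sup>2 * (cmod (ell2_nth x 1))\<^sup>2 + K\<^sup>2 * R"
    using assms \<open>0 \<le> R\<close> by (intro add_mono mult_right_mono power_mono) auto
  also have "\<dots> = (K * norm x)\<^sup>2"
    unfolding power_mult_distrib norm_ell2_split[of x] R_def by (simp add: distrib_left)
  finally show "(norm (swap_op a b x))\<^sup>2 \<le> (K * norm x)\<^sup>2" .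
qed (use assms in simp)

lemma bounded_clinear_swap_op: "bounded_clinear (swap_op a b)"
proof -
  have "norm (swap_op a b x) \<le> norm x * (1 + cmod a + cmod b)" for x
    using norm_swap_op_le[of a "1 + cmod a + cmod b" b x] by (simp add: mult.commute)
  then have "bounded_linear (swap_op a b)"
    by (intro bounded_linear_intro[where K = "1 + cmod a + cmod b"])
       (auto intro!: ell2_eqI simp: swap_op_nth plus_ell2.rep_eq scaleR_ell2.rep_eq algebra_simps)
  then show ?thesis
    by (auto intro!: ell2_eqI simp: bounded_clinear_def swap_op_nth scaleC_ell2.rep_eq)
qed

lift_definition ell2_unit :: "nat \<Rightarrow> ell2" is "\<lambda>m n. if n = m then 1 else 0"
  by (rule summable_finite[of "{m}" for m]) auto

lemma swap_op_inverse:
  assumes "a \<noteq> 0" "b \<noteq> 0"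
  shows "swap_op a b (swap_op (1 / b) (1 / a) x) = x"
  using assms by (intro ell2_eqI) (simp add: swap_op_nth)

lemma invertible_swap_op:
  assumes "a \<noteq> 0" "b \<noteq> 0"
  shows "invertible_op (swap_op a b)" "inv (swap_op a b) = swap_op (1 / b) (1 / a)"
proof -
  have *: "swap_op (1 / b) (1 / a) \<circ> swap_op a b = id" "swap_op a b \<circ> swap_op (1 / b) (1 / a) = id"
    using swap_op_inverse[of a b] swap_op_inverse[of "1 / b" "1 / a"] assms
    by (auto simp: fun_eq_iff)
  then show "invertible_op (swap_op a b)"
    using bounded_clinear_swap_op unfolding invertible_op_def by blast
  show "inv (swap_op a b) = swap_op (1 / b) (1 / a)"
    using * by (intro inv_unique_comp)
qed

text \<open>The form is diagonal, and it vanishes outside the first two coordinates, where \<open>T\<close> is the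
  identity.\<close>

lemma swap_op_mem_C_alpha_iff:
  assumes "a \<noteq> 0" "b \<noteq> 0"
  shows "swap_op a b \<in> C_alpha r \<longleftrightarrow>
    (cmod a * cmod b)\<^sup>2 + r\<^sup>2 \<le> (1 + r\<^sup>2) * (cmod a)\<^sup>2 \<and>
    (cmod a * cmod b)\<^sup>2 + r\<^sup>2 \<le> (1 + r\<^sup>2) * (cmod b)\<^sup>2"
proof -
  define p where "p = (1 + r\<^sup>2) * (cmod b)\<^sup>2 - (cmod a * cmod b)\<^sup>2 - r\<^sup>2"
  define q where "q = (1 + r\<^sup>2) * (cmod a)\<^sup>2 - (cmod a * cmod b)\<^sup>2 - r\<^sup>2"
  let ?T = "swap_op a b"
  have form: "(1 + r\<^sup>2) * (norm (?T x))\<^sup>2 - (norm (?T (?T x)))\<^sup>2 - r\<^sup>2 * (norm x)\<^sup>2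
      = p * (cmod (ell2_nth x 0))\<^sup>2 + q * (cmod (ell2_nth x 1))\<^sup>2" for x
    by (simp add: norm_swap_op swap_op_nth norm_mult power_mult_distrib p_def q_def algebra_simps)
  have "(\<forall>x. (norm (?T (?T x)))\<^sup>2 + r\<^sup>2 * (norm x)\<^sup>2 \<le> (1 + r\<^sup>2) * (norm (?T x))\<^sup>2)
      \<longleftrightarrow> (\<forall>x. 0 \<le> p * (cmod (ell2_nth x 0))\<^sup>2 + q * (cmod (ell2_nth x 1))\<^sup>2)"
    unfolding form[symmetric] by (simp add: algebra_simps)
  also have "\<dots> \<longleftrightarrow> 0 \<le> p \<and> 0 \<le> q"
  proof
    assume *: "\<forall>x. 0 \<le> p * (cmod (ell2_nth x 0))\<^sup>2 + q * (cmod (ell2_nth x 1))\<^sup>2"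
    from *[rule_format, of "ell2_unit 0"] *[rule_format, of "ell2_unit 1"]
    show "0 \<le> p \<and> 0 \<le> q" by (simp add: ell2_unit.rep_eq)
  qed simp
  finally show ?thesis
    using bounded_clinear_swap_op invertible_swap_op[OF assms]
    by (auto simp: mem_C_alpha_iff p_def q_def)
qed

text \<open>The singular values \<open>1\<close> and \<open>r\<close> are as extreme as the norm bounds permit, and \<open>T\<^sup>2\<close> acts on the first
  two coordinates as \<open>r\<close>: at the unit vector that \<open>T\<close> shrinks by \<open>r\<close>, the inequality of \<open>C_alpha r\<close>
  would be \<open>2 r\<^sup>2 \<le> (1 + r\<^sup>2) r\<^sup>2\<close>.\<close>

lemma swap_op_in_C_1r_not_C_alpha:
  assumes r: "0 < r" "r < 1"
  shows "swap_op 1 (of_real r) \<in> C_1r r" "swap_op 1 (of_real r) \<notin> C_alpha r"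
proof -
  have "onorm (swap_op 1 (of_real r)) \<le> 1"
    using r norm_swap_op_le[of 1 1 "of_real r"] by (intro onorm_bound) auto
  moreover have "onorm (swap_op (1 / of_real r) (1 / 1)) \<le> 1 / r"
    using r by (intro onorm_bound norm_swap_op_le) (auto simp: norm_divide)
  ultimately show "swap_op 1 (of_real r) \<in> C_1r r"
    using bounded_clinear_swap_op invertible_swap_op[of 1 "of_real r"] r by (simp add: C_1r_def)
  have "r\<^sup>2 * r\<^sup>2 < r\<^sup>2 * 1"
    using r by (intro mult_strict_left_mono) (auto simp: power_less_one_iff)
  then show "swap_op 1 (of_real r) \<notin> C_alpha r"
    using r by (simp add: swap_op_mem_C_alpha_iff algebra_simps)
qed

text \<open>Here \<open>b = r / a\<close>, so that \<open>T\<^sup>2\<close> acts as \<open>r\<close> on the first two coordinates, and \<open>a\<close> is chosen to make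
  the inequality of \<open>C_alpha r\<close> an equality at the first unit vector. For \<open>f(z) = z + r / z\<close>,
  \<open>f(T) = T + r T\<^sup>-\<^sup>1 = 2 T\<close> on these coordinates, whose norm is at least \<open>2 a\<close>. On the annulus, however,
  \<open>\<bar>f(z)\<bar> \<le> \<bar>z\<bar> + r / \<bar>z\<bar> \<le> 1 + r\<close>, because \<open>(1 - \<bar>z\<bar>) (\<bar>z\<bar> - r) \<ge> 0\<close>.\<close>

lemma swap_op_in_C_alpha_not_Sp_annulus:
  assumes r: "0 < r" "r < 1"
  defines "a \<equiv> sqrt ((1 + r\<^sup>2) / 2)"
  shows "swap_op (of_real a) (of_real (r / a)) \<in> C_alpha r"
    "swap_op (of_real a) (of_real (r / a)) \<notin> Sp_annulus r"
proof -
  have pos: "0 < 1 + r\<^sup>2" by (simp add: add_pos_nonneg)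
  then have a: "0 < a" "a\<^sup>2 = (1 + r\<^sup>2) / 2" by (simp_all add: a_def)
  define b where "b = r / a"
  have b: "0 < b" "a * b = r" using a r by (simp_all add: b_def)
  have "(1 + r\<^sup>2) * b\<^sup>2 = 2 * (a * b)\<^sup>2"
    using a(2) by (simp add: power_mult_distrib)
  moreover have "0 \<le> (1 - r\<^sup>2)\<^sup>2" by simp
  then have "2 * r\<^sup>2 \<le> (1 + r\<^sup>2) * a\<^sup>2"
    unfolding a(2) by (simp add: power2_eq_square algebra_simps)
  ultimately have "swap_op (of_real a) (of_real b) \<in> C_alpha r"
    using a(1) b by (subst swap_op_mem_C_alpha_iff) auto
  then show "swap_op (of_real a) (of_real (r / a)) \<in> C_alpha r" by (simp add: b_def)
  let ?T = "swap_op (of_real a) (of_real b)"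
  have "?T \<notin> Sp_annulus r"
  proof
    assume T: "?T \<in> Sp_annulus r"
    define p :: "complex poly" where "p = monom 1 2 + monom (of_real r) 0"
    have "cmod (poly p z / z ^ 1) \<le> 1 + r" if "z \<in> closed_annulus r" for z
    proof -
      have t: "r \<le> cmod z" "cmod z \<le> 1" using that by (auto simp: closed_annulus_def)
      then have "0 \<le> (1 - cmod z) * (cmod z - r)" by simp
      then have "(cmod z)\<^sup>2 + r \<le> (1 + r) * cmod z" by (simp add: power2_eq_square algebra_simps)
      moreover have "cmod (poly p z) \<le> (cmod z)\<^sup>2 + r"
        using norm_triangle_ineq[of "z\<^sup>2" "of_real r"] r
        by (simp add: p_def poly_monom norm_power)
      ultimately show ?thesis using t r by (simp add: norm_divide divide_le_eq)
    qed
    \<comment> \<open>this tests \<open>f(T)\<close> on the vector \<open>T e\<^sub>0 = b e\<^sub>1\<close>, with \<open>e\<^sub>0, e\<^sub>1\<close> the first two unit vectors\<close>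
    from Sp_annulus_laurent_bound[OF r T this, of "ell2_unit 0"]
    have "norm (poly_op p ?T (ell2_unit 0)) \<le> (1 + r) * norm (?T (ell2_unit 0))" by simp
    moreover have "of_real a * of_real b = complex_of_real r" using b(2) by (metis of_real_mult)
    then have "poly_op p ?T (ell2_unit 0) = (2 * of_real r) *\<^sub>C ell2_unit 0"
      by (intro ell2_eqI)
        (simp add: p_def poly_op_add poly_op_monom numeral_2_eq_2 plus_ell2.rep_eq
          scaleC_ell2.rep_eq swap_op_nth ell2_unit.rep_eq)
    moreover have "norm (ell2_unit 0) = 1"
      using norm_ell2_split[of "ell2_unit 0"] power2_eq_iff_nonneg[of "norm (ell2_unit 0)" 1]
      by (simp add: ell2_unit.rep_eq)
    moreover have "norm (?T (ell2_unit 0)) = b"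
    proof -
      have "(norm (?T (ell2_unit 0)))\<^sup>2 = b\<^sup>2"
        using \<open>norm (ell2_unit 0) = 1\<close> b by (simp add: norm_swap_op ell2_unit.rep_eq)
      then show ?thesis using b by (simp add: power2_eq_iff_nonneg)
    qed
    ultimately have "2 * (a * b) \<le> (1 + r) * b" using b r by (simp add: norm_scaleC norm_mult)
    then have "2 * a \<le> 1 + r"
      using b(1) by (simp only: mult.assoc[symmetric] mult_le_cancel_right_pos)
    then have "(2 * a)\<^sup>2 \<le> (1 + r)\<^sup>2" using a by (intro power_mono) auto
    moreover have "0 < (1 - r)\<^sup>2" using r by simp
    ultimately show False using a(2) by (simp add: power_mult_distrib power2_eq_square algebra_simps)
  qed
  then show "swap_op (of_real a) (of_real (r / a)) \<notin> Sp_annulus r" by (simp add: b_def)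
qed

section \<open>The chain of strict inclusions\<close>

theorem theorem1p1:
  fixes r :: real
  assumes "0 < r" and "r < 1"
  shows "(Sp_annulus r :: ('a::chilbert_space \<Rightarrow> 'a) set) \<subseteq> C_alpha r
     \<and> (\<exists>T :: ell2 \<Rightarrow> ell2. T \<in> C_alpha r \<and> T \<notin> Sp_annulus r)
     \<and> (C_alpha r :: ('a::chilbert_space \<Rightarrow> 'a) set) \<subseteq> C_1r r
     \<and> (\<exists>T :: ell2 \<Rightarrow> ell2. T \<in> C_1r r \<and> T \<notin> C_alpha r)"
  using Sp_annulus_subset_C_alpha[OF assms] C_alpha_subset_C_1r[OF assms]
    swap_op_in_C_alpha_not_Sp_annulus[OF assms] swap_op_in_C_1r_not_C_alpha[OF assms]
  by blast

end
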